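(* Let $(H_n)_{n\in\omega}$ be a sequence of countable discrete abelian groups and $G\le\prod_nH_n$ a closed subgroup. Suppose that for every prime $p$ and every $n\in\omega$, $G_{\langle n\rangle}/G_{\langle n+1\rangle}$ is $p$-compact. Then every group tree $S\subseteq T_G$ satisfies $\mathrm{ht}(S)\le\omega$, and every coset tree $S\subseteq T_G$ satisfies $\mathrm{ht}(S)<\omega\cdot2$.
   Context: For a prime $p$, a group $\Gamma$ is $p$-compact if for every decreasing sequence $(K_n)$ of subgroups of $\mathbb{Z}(p)\times\Gamma$ with $\pi[K_n]=\mathbb{Z}(p)$ for all $n$ (where $\pi:\mathbb{Z}(p)\times\Gamma\to\mathbb{Z}(p)$ is the projection), we have $\pi[\bigcap_nK_n]=\mathbb{Z}(p)$. Let $\pi_k:\prod_nH_n\to H_k$ be the projections; $G_{\langle 0\rangle}=G$ and for $m\ge1$, $G_{\langle m\rangle}=\{x\in G:\pi_k(x)=0\text{ for all }k<m\}$. For $n\ge1$ let $H^n=H_0\times\cdots\times H_{n-1}$ and $T_H=\bigcup_{n\ge1}H^n$; for $\sigma\in H^n$, $\mathrm{lh}(\sigma)=n$; $\sigma\subseteq\tau$ means $\sigma$ is the restriction of $\tau$ to its first $\mathrm{lh}(\sigma)$ coordinates, similarly $\sigma\subseteq x$ for $x\in\prod_nH_n$. A tree is a subset of $T_H$ closed under restriction; $T_G=\{\sigma\in T_H:\exists x\in G\ \sigma\subseteq x\}$. A group tree is a tree $S$ with each $S\cap H^m$ ($m\ge1$) a subgroup of $H^m$; a coset tree is a tree with each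 $S\cap H^m$ empty or a coset of a subgroup of $H^m$. $D(S)=\{\sigma\in S:\exists\tau\in S\ (\sigma\subseteq\tau,\ \mathrm{lh}(\sigma)<\mathrm{lh}(\tau))\}$; $D^0(S)=S$, $D^{\alpha+1}(S)=D(D^\alpha(S))$, $D^\lambda(S)=\bigcap_{\alpha<\lambda}D^\alpha(S)$ for limit $\lambda$; $\mathrm{ht}(S)$ is the least $\alpha$ with $D^{\alpha+1}(S)=D^\alpha(S)$. *)

theory Defs
  imports
    "HOL-Analysis.Function_Topology"
    "HOL-Algebra.Elementary_Groups"
    "HOL-Algebra.Product_Groups"
    "HOL-Algebra.Weak_Morphisms"
    "HOL-Library.Countable_Set_Type"
    "HOL-Library.Sublist"
    "HOL-Computational_Algebra.Primes"
begin

text \<open>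
  HOL has no type of all ordinals. The well-order \<open>cardSuc natLeq\<close> has order type \<open>\<omega>\<^sub>1\<close>,
  so the elements of its field are, in increasing order, exactly the countable ordinals.
  The trees considered below are countable (\<open>countable_full_tree\<close>), so their heights are
  countable ordinals (\<open>tree_height_attained\<close>).
\<close>

lemma Well_order_cardSuc_natLeq: "Well_order (cardSuc natLeq)"
  by (rule cardSuc_Well_order[OF natLeq_Card_order])

typedef countable_ordinal = "Field (cardSuc natLeq)"
  using Field_cardSuc_not_empty[OF natLeq_Card_order] by auto

instantiation countable_ordinal :: wellorder
begin

definition less_eq_countable_ordinal :: "countable_ordinal \<Rightarrow> countable_ordinal \<Rightarrow> bool" where
  "\<alpha> \<le> \<beta> \<longleftrightarrow> (Rep_countable_ordinal \<alpha>, Rep_countable_ordinal \<beta>) \<in> cardSuc natLeq"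

definition less_countable_ordinal :: "countable_ordinal \<Rightarrow> countable_ordinal \<Rightarrow> bool" where
  "\<alpha> < \<beta> \<longleftrightarrow> \<alpha> \<le> \<beta> \<and> \<not> \<beta> \<le> (\<alpha>::countable_ordinal)"

instance
proof
  interpret wo_rel "cardSuc natLeq"
    using Well_order_cardSuc_natLeq by (simp add: wo_rel_def)
  fix \<alpha> \<beta> \<gamma> :: countable_ordinal
  note R = Rep_countable_ordinal
  show "\<alpha> < \<beta> \<longleftrightarrow> \<alpha> \<le> \<beta> \<and> \<not> \<beta> \<le> \<alpha>"
    by (rule less_countable_ordinal_def)
  show "\<alpha> \<le> \<alpha>"
    using REFL R[of \<alpha>] by (simp add: less_eq_countable_ordinal_def refl_on_def)
  show "\<alpha> \<le> \<beta> \<Longrightarrow> \<beta> \<le> \<gamma> \<Longrightarrow> \<alpha> \<le> \<gamma>"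
    using TRANS unfolding less_eq_countable_ordinal_def by (meson transD)
  show "\<alpha> \<le> \<beta> \<Longrightarrow> \<beta> \<le> \<alpha> \<Longrightarrow> \<alpha> = \<beta>"
    using ANTISYM unfolding less_eq_countable_ordinal_def
    by (meson antisymD Rep_countable_ordinal_inject)
  show "\<alpha> \<le> \<beta> \<or> \<beta> \<le> \<alpha>"
    using TOTALS R[of \<alpha>] R[of \<beta>] unfolding less_eq_countable_ordinal_def by blast
next
  fix P :: "countable_ordinal \<Rightarrow> bool" and \<alpha>
  assume step: "\<And>\<alpha>. (\<And>\<beta>. \<beta> < \<alpha> \<Longrightarrow> P \<beta>) \<Longrightarrow> P \<alpha>"
  have wf: "wf (inv_image (cardSuc natLeq - Id) Rep_countable_ordinal)"
    using Well_order_cardSuc_natLeq by (simp add: well_order_on_def)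
  show "P \<alpha>"
  proof (induction \<alpha> rule: wf_induct_rule[OF wf])
    case (1 \<alpha>)
    show ?case
    proof (rule step)
      fix \<beta> assume "\<beta> < \<alpha>"
      then have "(\<beta>, \<alpha>) \<in> inv_image (cardSuc natLeq - Id) Rep_countable_ordinal"
        by (auto simp: less_countable_ordinal_def less_eq_countable_ordinal_def)
      then show "P \<beta>" by (rule 1)
    qed
  qed
qed

end

instantiation countable_ordinal :: zero
begin
definition zero_countable_ordinal :: countable_ordinal where "0 = (LEAST \<alpha>::countable_ordinal. True)"
instance ..
end

definition ord_succ :: "countable_ordinal \<Rightarrow> countable_ordinal" where
  "ord_succ \<alpha> = (LEAST \<beta>. \<alpha> < \<beta>)"

definition ord_omega :: countable_ordinal where
  "ord_omega = (LEAST \<alpha>. \<forall>n. (ord_succ ^^ n) 0 < \<alpha>)"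

text \<open>\<open>\<omega> \<cdot> 2 = \<omega> + \<omega>\<close> is the supremum of the ordinals \<open>\<omega> + n\<close>.\<close>

definition ord_omega_2 :: countable_ordinal where
  "ord_omega_2 = (LEAST \<alpha>. \<forall>n. (ord_succ ^^ n) ord_omega < \<alpha>)"

text \<open>The least upper bounds above exist, since \<open>\<omega>\<^sub>1\<close> is regular.\<close>

lemma countable_ordinal_bounded:
  includes cardinal_syntax
  fixes B :: "countable_ordinal set"
  assumes "countable B"
  shows "\<exists>\<alpha>. \<forall>\<beta>\<in>B. \<beta> < \<alpha>"
proof -
  let ?r = "cardSuc natLeq" and ?K = "Rep_countable_ordinal ` B"
  have card: "Card_order ?r" and inf: "infinite (Field ?r)"
    using cardSuc_Card_order[OF natLeq_Card_order] cardSuc_finite[OF natLeq_Card_order]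
    by (simp_all only: Field_natLeq infinite_UNIV_nat not_False_eq_True)
  have "regularCard ?r"
    by (rule infinite_cardSuc_regularCard[OF _ natLeq_Card_order]) (simp add: Field_natLeq)
  moreover have "?K \<subseteq> Field ?r"
    using Rep_countable_ordinal by blast
  moreover have "\<not> |?K| =o ?r"
    using countable_image[OF assms] cardSuc_greater[OF natLeq_Card_order]
    by (metis countable_card_le_natLeq not_ordLess_ordLeq ordIso_symmetric
          ordIso_ordLeq_trans)
  ultimately have "\<not> cofinal ?K ?r"
    unfolding regularCard_def by blast
  then obtain a where a: "a \<in> Field ?r" and "\<forall>b\<in>?K. \<not> (a \<noteq> b \<and> (a, b) \<in> ?r)"
    unfolding cofinal_def by blast
  then have up: "\<not> Abs_countable_ordinal a < \<beta>" if "\<beta> \<in> B" for \<beta>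
    using that
    by (auto simp: less_countable_ordinal_def less_eq_countable_ordinal_def
        Abs_countable_ordinal_inverse)
  obtain c where c: "c \<in> Field ?r" "a \<noteq> c" "(a, c) \<in> ?r"
    using infinite_Card_order_limit[OF card inf a] by blast
  have "Abs_countable_ordinal a < Abs_countable_ordinal c"
    using c a by (simp add: order_less_le less_eq_countable_ordinal_def
        Abs_countable_ordinal_inverse Abs_countable_ordinal_inject)
  then show ?thesis
    using up by (meson not_less le_less_trans)
qed

lemma ord_zero_le [simp]: "(0::countable_ordinal) \<le> \<alpha>"
  unfolding zero_countable_ordinal_def by (simp add: Least_le)

lemma ord_less_succ [simp]: "\<alpha> < ord_succ \<alpha>"
  unfolding ord_succ_def using countable_ordinal_bounded[of "{\<alpha>}"] by (auto intro: LeastI)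

lemma ord_less_succ_iff [simp]: "\<beta> < ord_succ \<alpha> \<longleftrightarrow> \<beta> \<le> \<alpha>"
proof
  show "\<beta> < ord_succ \<alpha> \<Longrightarrow> \<beta> \<le> \<alpha>"
    unfolding ord_succ_def using not_less_Least not_le by blast
  show "\<beta> \<le> \<alpha> \<Longrightarrow> \<beta> < ord_succ \<alpha>"
    by (rule le_less_trans[OF _ ord_less_succ])
qed

lemma ord_succ_inject [simp]: "ord_succ \<alpha> = ord_succ \<beta> \<longleftrightarrow> \<alpha> = \<beta>"
  by (metis antisym ord_less_succ ord_less_succ_iff)

lemma ord_succ_neq_zero [simp]: "ord_succ \<alpha> \<noteq> 0"
  by (metis ord_less_succ ord_zero_le not_less)

lemma ord_less_omega_iff: "\<alpha> < ord_omega \<longleftrightarrow> (\<exists>n. \<alpha> \<le> (ord_succ ^^ n) 0)"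
proof -
  have "\<exists>\<alpha>. \<forall>n. (ord_succ ^^ n) 0 < \<alpha>"
    using countable_ordinal_bounded[of "range (\<lambda>n. (ord_succ ^^ n) 0)"] by simp
  then have "\<forall>n. (ord_succ ^^ n) 0 < ord_omega"
    unfolding ord_omega_def by (rule LeastI_ex)
  moreover have "\<exists>n. \<alpha> \<le> (ord_succ ^^ n) 0" if "\<alpha> < ord_omega"
    using not_less_Least[OF that[unfolded ord_omega_def]] by (simp add: not_less)
  ultimately show ?thesis by (meson le_less_trans)
qed

lemma ord_less_omega_2_iff: "\<alpha> < ord_omega_2 \<longleftrightarrow> (\<exists>n. \<alpha> \<le> (ord_succ ^^ n) ord_omega)"
proof -
  have "\<exists>\<alpha>. \<forall>n. (ord_succ ^^ n) ord_omega < \<alpha>"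
    using countable_ordinal_bounded[of "range (\<lambda>n. (ord_succ ^^ n) ord_omega)"] by simp
  then have "\<forall>n. (ord_succ ^^ n) ord_omega < ord_omega_2"
    unfolding ord_omega_2_def by (rule LeastI_ex)
  moreover have "\<exists>n. \<alpha> \<le> (ord_succ ^^ n) ord_omega" if "\<alpha> < ord_omega_2"
    using not_less_Least[OF that[unfolded ord_omega_2_def]] by (simp add: not_less)
  ultimately show ?thesis by (meson le_less_trans)
qed

definition p_compact :: "nat \<Rightarrow> ('a, 'b) monoid_scheme \<Rightarrow> bool" where
  "p_compact p \<Gamma> \<longleftrightarrow>
     (\<forall>K :: nat \<Rightarrow> (int \<times> 'a) set.
        (\<forall>n. subgroup (K n) (integer_mod_group p \<times>\<times> \<Gamma>)) \<and> decseq K \<and>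
        (\<forall>n. fst ` K n = carrier (integer_mod_group p))
        \<longrightarrow> fst ` (\<Inter>n. K n) = carrier (integer_mod_group p))"

definition initial_kernel ::
  "(nat \<Rightarrow> ('a, 'b) monoid_scheme) \<Rightarrow> (nat \<Rightarrow> 'a) set \<Rightarrow> nat \<Rightarrow> (nat \<Rightarrow> 'a) set" where
  "initial_kernel H G m = {x \<in> G. \<forall>k<m. x k = \<one>\<^bsub>H k\<^esub>}"

definition filtration_quotient ::
  "(nat \<Rightarrow> ('a, 'b) monoid_scheme) \<Rightarrow> (nat \<Rightarrow> 'a) set \<Rightarrow> nat \<Rightarrow> (nat \<Rightarrow> 'a) set monoid" where
  "filtration_quotient H G n =
     (product_group UNIV H)\<lparr>carrier := initial_kernel H G n\<rparr> Mod initial_kernel H G (Suc n)"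

text \<open>Finite sequences are lists, so \<open>lh\<close> is \<open>length\<close> and \<open>\<sigma> \<subseteq> \<tau>\<close> is \<open>prefix \<sigma> \<tau>\<close>.\<close>

definition fin_product :: "(nat \<Rightarrow> ('a, 'b) monoid_scheme) \<Rightarrow> nat \<Rightarrow> 'a list monoid" where
  "fin_product H n = DirProd_list (map H [0..<n])"

lemma carrier_fin_product:
  "carrier (fin_product H n) = {\<sigma>. length \<sigma> = n \<and> (\<forall>i<n. \<sigma> ! i \<in> carrier (H i))}"
  unfolding fin_product_def
  by (auto dest: DirProd_list_carrier_mem intro!: DirProd_list_carrier_memI)

lemma mult_DirProd_list:
  assumes "\<sigma> \<in> carrier (DirProd_list Gs)" "\<tau> \<in> carrier (DirProd_list Gs)"
  shows "\<sigma> \<otimes>\<^bsub>DirProd_list Gs\<^esub> \<tau> = map (\<lambda>i. \<sigma> ! i \<otimes>\<^bsub>Gs ! i\<^esub> \<tau> ! i) [0..<length Gs]"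
  using assms
proof (induction Gs arbitrary: \<sigma> \<tau>)
  case Nil
  then show ?case by (simp add: DirProd_list_def)
next
  case (Cons G Gs)
  obtain g \<sigma>' where s: "\<sigma> = g # \<sigma>'" "g \<in> carrier G" "\<sigma>' \<in> carrier (DirProd_list Gs)"
    using Cons.prems(1) by (auto simp: DirProd_list_carrier)
  obtain h \<tau>' where t: "\<tau> = h # \<tau>'" "h \<in> carrier G" "\<tau>' \<in> carrier (DirProd_list Gs)"
    using Cons.prems(2) by (auto simp: DirProd_list_carrier)
  have "(g, \<sigma>') \<otimes>\<^bsub>G \<times>\<times> DirProd_list Gs\<^esub> (h, \<tau>') = (g \<otimes>\<^bsub>G\<^esub> h, \<sigma>' \<otimes>\<^bsub>DirProd_list Gs\<^esub> \<tau>')"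
    by simp
  then have "\<sigma> \<otimes>\<^bsub>DirProd_list (G # Gs)\<^esub> \<tau> = (g \<otimes>\<^bsub>G\<^esub> h) # (\<sigma>' \<otimes>\<^bsub>DirProd_list Gs\<^esub> \<tau>')"
    using DirProd_list_iso[of G Gs] s t
    by (fastforce simp: iso_def hom_def DirProd_def)
  then show ?case
    using Cons.IH[OF s(3) t(3)] s(1) t(1)
    by (simp add: map_Suc_upt[symmetric] upt_rec[of 0 "Suc _"] del: upt_Suc)
qed

lemma mult_fin_product:
  assumes "\<sigma> \<in> carrier (fin_product H n)" "\<tau> \<in> carrier (fin_product H n)"
  shows "\<sigma> \<otimes>\<^bsub>fin_product H n\<^esub> \<tau> = map (\<lambda>i. \<sigma> ! i \<otimes>\<^bsub>H i\<^esub> \<tau> ! i) [0..<n]"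
  using mult_DirProd_list[OF assms[unfolded fin_product_def]]
  by (simp add: fin_product_def cong: map_cong)

definition full_tree :: "(nat \<Rightarrow> ('a, 'b) monoid_scheme) \<Rightarrow> 'a list set" where
  "full_tree H = (\<Union>n\<in>{1..}. carrier (fin_product H n))"

lemma countable_full_tree:
  assumes "\<And>n. countable (carrier (H n))"
  shows "countable (full_tree H)"
proof (rule countable_subset)
  show "full_tree H \<subseteq> lists (\<Union>n. carrier (H n))"
    by (fastforce simp: full_tree_def carrier_fin_product in_set_conv_nth)
  show "countable (lists (\<Union>n. carrier (H n)))"
    using assms by (intro countable_lists countable_UN) auto
qed

definition is_tree :: "(nat \<Rightarrow> ('a, 'b) monoid_scheme) \<Rightarrow> 'a list set \<Rightarrow> bool" where
  "is_tree H S \<longleftrightarrow>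
     S \<subseteq> full_tree H \<and> (\<forall>\<tau>\<in>S. \<forall>\<sigma>\<in>full_tree H. prefix \<sigma> \<tau> \<longrightarrow> \<sigma> \<in> S)"

definition tree_of ::
  "(nat \<Rightarrow> ('a, 'b) monoid_scheme) \<Rightarrow> (nat \<Rightarrow> 'a) set \<Rightarrow> 'a list set" where
  "tree_of H G = {\<sigma> \<in> full_tree H. \<exists>x\<in>G. \<sigma> = map x [0..<length \<sigma>]}"

definition group_tree :: "(nat \<Rightarrow> ('a, 'b) monoid_scheme) \<Rightarrow> 'a list set \<Rightarrow> bool" where
  "group_tree H S \<longleftrightarrow>
     is_tree H S \<and>
     (\<forall>m\<ge>1. subgroup (S \<inter> carrier (fin_product H m)) (fin_product H m))"

definition coset_tree :: "(nat \<Rightarrow> ('a, 'b) monoid_scheme) \<Rightarrow> 'a list set \<Rightarrow> bool" where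
  "coset_tree H S \<longleftrightarrow>
     is_tree H S \<and>
     (\<forall>m\<ge>1. S \<inter> carrier (fin_product H m) = {} \<or>
        (\<exists>K. subgroup K (fin_product H m) \<and>
             S \<inter> carrier (fin_product H m) \<in> rcosets\<^bsub>fin_product H m\<^esub> K))"

definition tree_deriv :: "'a list set \<Rightarrow> 'a list set" where
  "tree_deriv S = {\<sigma> \<in> S. \<exists>\<tau>\<in>S. prefix \<sigma> \<tau> \<and> length \<sigma> < length \<tau>}"

function tree_deriv_iter :: "countable_ordinal \<Rightarrow> 'a list set \<Rightarrow> 'a list set" where
  "tree_deriv_iter \<alpha> S =
     (if \<alpha> = 0 then S
      else if \<exists>\<beta>. \<alpha> = ord_succ \<beta> then tree_deriv (tree_deriv_iter (THE \<beta>. \<alpha> = ord_succ \<beta>) S)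
      else (\<Inter>\<beta>\<in>{..<\<alpha>}. tree_deriv_iter \<beta> S))"
  by pat_completeness auto
termination
  by (relation "inv_image {(\<alpha>, \<beta>). \<alpha> < \<beta>} fst") (auto simp: wf)

declare tree_deriv_iter.simps [simp del]

lemma tree_deriv_iter_0: "tree_deriv_iter 0 S = S"
  by (simp add: tree_deriv_iter.simps)

lemma tree_deriv_iter_succ:
  "tree_deriv_iter (ord_succ \<alpha>) S = tree_deriv (tree_deriv_iter \<alpha> S)"
  by (subst tree_deriv_iter.simps) simp

lemma tree_deriv_iter_limit:
  assumes "\<alpha> \<noteq> 0" "\<nexists>\<beta>. \<alpha> = ord_succ \<beta>"
  shows "tree_deriv_iter \<alpha> S = (\<Inter>\<beta>\<in>{..<\<alpha>}. tree_deriv_iter \<beta> S)"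
  using assms by (subst tree_deriv_iter.simps) simp

definition tree_height :: "'a list set \<Rightarrow> countable_ordinal" where
  "tree_height S =
     (LEAST \<alpha>. tree_deriv_iter (ord_succ \<alpha>) S = tree_deriv_iter \<alpha> S)"

lemma tree_deriv_iter_antimono:
  "\<beta> \<le> \<alpha> \<Longrightarrow> tree_deriv_iter \<alpha> S \<subseteq> tree_deriv_iter \<beta> S"
proof (induction \<alpha> rule: less_induct)
  case (less \<alpha>)
  consider "\<beta> = \<alpha>" | \<gamma> where "\<beta> < \<alpha>" "\<alpha> = ord_succ \<gamma>"
    | "\<beta> < \<alpha>" "\<nexists>\<gamma>. \<alpha> = ord_succ \<gamma>"
    using less.prems by (metis order_le_less)
  then show ?case
  proof cases
    case 2
    then have "tree_deriv_iter \<gamma> S \<subseteq> tree_deriv_iter \<beta> S"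
      by (intro less.IH) auto
    then show ?thesis
      using 2 by (auto simp: tree_deriv_iter_succ tree_deriv_def)
  next
    case 3
    then have "\<alpha> \<noteq> 0"
      using ord_zero_le not_less by blast
    then show ?thesis
      using 3 by (auto simp: tree_deriv_iter_limit)
  qed simp
qed

lemma tree_height_attained:
  assumes "countable S"
  shows "tree_deriv_iter (ord_succ (tree_height S)) S = tree_deriv_iter (tree_height S) S"
proof -
  have "\<exists>\<alpha>. tree_deriv_iter (ord_succ \<alpha>) S = tree_deriv_iter \<alpha> S"
  proof (rule ccontr)
    assume no: "\<nexists>\<alpha>. tree_deriv_iter (ord_succ \<alpha>) S = tree_deriv_iter \<alpha> S"
    have "\<exists>\<sigma>. \<sigma> \<in> tree_deriv_iter \<alpha> S - tree_deriv_iter (ord_succ \<alpha>) S" for \<alpha>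
      using no tree_deriv_iter_antimono[of \<alpha> "ord_succ \<alpha>" S] by (auto simp: less_imp_le)
    then obtain f where
      f: "f \<alpha> \<in> tree_deriv_iter \<alpha> S - tree_deriv_iter (ord_succ \<alpha>) S" for \<alpha>
      by metis
    have ne: "f \<alpha> \<noteq> f \<beta>" if "\<alpha> < \<beta>" for \<alpha> \<beta>
    proof -
      have "ord_succ \<alpha> \<le> \<beta>"
        using that by (meson ord_less_succ_iff not_less)
      then show ?thesis
        using f[of \<alpha>] f[of \<beta>] tree_deriv_iter_antimono[of "ord_succ \<alpha>" \<beta> S] by auto
    qed
    have "inj f"
      by (rule linorder_injI) (rule ne)
    moreover have "range f \<subseteq> S"
      using f tree_deriv_iter_antimono[of 0 _ S] by (fastforce simp: tree_deriv_iter_0)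
    ultimately have "countable (UNIV :: countable_ordinal set)"
      using assms countable_subset countable_image_inj_on by metis
    from countable_ordinal_bounded[OF this] show False by auto
  qed
  then show ?thesis
    unfolding tree_height_def by (rule LeastI_ex)
qed

end

theory Submission
  imports Defs "HOL-Algebra.Multiplicative_Group"
begin

text \<open>
  Let \<open>A\<^sub>m\<close> be the kernel of the restriction \<open>T\<^sub>G \<inter> H\<^sup>m\<^sup>+\<^sup>1 \<rightarrow> T\<^sub>G \<inter> H\<^sup>m\<close>, which is isomorphic to
  \<open>G\<^sub>\<langle>\<^sub>m\<^sub>\<rangle> / G\<^sub>\<langle>\<^sub>m\<^sub>+\<^sub>1\<^sub>\<rangle>\<close>. As \<open>A\<^sub>m\<close> is countable and \<open>p\<close>-compact for every \<open>p\<close>, it is a torsion group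
  whose \<open>p\<close>-primary subgroups satisfy the descending chain condition; hence every level of \<open>T\<^sub>G\<close>
  is torsion. Given a group tree \<open>S\<close> and \<open>\<sigma>\<close> in level \<open>m\<close> of \<open>D\<^sup>\<omega>(S)\<close>, the images of the higher levels
  in level \<open>m + 1\<close> decrease and each of them contains an extension of \<open>\<sigma>\<close>. If \<open>\<sigma>\<close> has prime power order,
  the extensions can be chosen of \<open>p\<close>-power order; the chain condition then makes one of them lie in all
  the images, and the general case follows by primary decomposition. So \<open>D\<^sup>\<omega>(S)\<close> is pruned. For a coset
  tree, either some level of \<open>D\<^sup>\<omega>(S)\<close> is empty and finitely many further derivatives leave nothing, or
  translation reduces to the group tree of differences.
\<close>

section \<open>Countable \<open>p\<close>-compact abelian groups\<close>

text \<open>The pairs \<open>(k mod p, a n [^] k \<otimes> c)\<close> with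
  \<open>c \<in> C n\<close> form a decreasing sequence of subgroups of Z(p) x \<open>G\<close>,
  each projecting onto Z(p). A point over 1 in their intersection is the required limit; this is the
  only form in which the definition of p-compactness is applied below.\<close>

lemma (in comm_group) p_compact_approximation:
  assumes pc: "p_compact p G" and p: "1 < p"
    and C: "\<And>n. subgroup (C n) G" "\<And>n. C (Suc n) \<subseteq> C n"
    and a: "\<And>n. a n \<in> carrier G"
    and step: "\<And>n. \<exists>k c. k mod int p = 1 \<and> c \<in> C n \<and> a (Suc n) = a n [^] (k::int) \<otimes> c"
  shows "\<exists>x\<in>carrier G. \<forall>n. \<exists>k c. k mod int p = 1 \<and> c \<in> C n \<and> x = a n [^] (k::int) \<otimes> c"
proof -
  define \<phi> where "\<phi> n = (\<lambda>(k::int, c). (k mod int p, a n [^] k \<otimes> c))" for n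
  define K where "K n = \<phi> n ` (UNIV \<times> C n)" for n
  have CG: "c \<in> carrier G" if "c \<in> C n" for c n
    using subgroup.subset[OF C(1)] that by blast
  have sub: "subgroup (K n) (integer_mod_group p \<times>\<times> G)" for n
  proof -
    let ?D = "integer_group \<times>\<times> (G\<lparr>carrier := C n\<rparr>)"
    have "group_hom ?D (integer_mod_group p \<times>\<times> G) (\<phi> n)"
    proof (intro group_hom.intro group_hom_axioms.intro homI)
      show "group ?D"
        using subgroup.subgroup_is_group[OF C(1) is_group] by (intro DirProd_group) simp_all
      show "group (integer_mod_group p \<times>\<times> G)"
        by (intro DirProd_group) (simp_all add: is_group)
      show "\<phi> n x \<in> carrier (integer_mod_group p \<times>\<times> G)" if "x \<in> carrier ?D" for x
        using that p CG a by (auto simp: \<phi>_def carrier_integer_mod_group)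
      show "\<phi> n (x \<otimes>\<^bsub>?D\<^esub> y) = \<phi> n x \<otimes>\<^bsub>integer_mod_group p \<times>\<times> G\<^esub> \<phi> n y"
        if "x \<in> carrier ?D" "y \<in> carrier ?D" for x y
        using that CG a[of n]
        by (auto simp: \<phi>_def int_pow_mult mod_add_eq m_ac)
    qed
    then have "subgroup (\<phi> n ` carrier ?D) (integer_mod_group p \<times>\<times> G)"
      by (rule group_hom.img_is_subgroup)
    then show ?thesis by (simp add: K_def)
  qed
  have "decseq K"
  proof (rule decseq_SucI, rule subsetI)
    fix n y assume "y \<in> K (Suc n)"
    then obtain k c where y: "c \<in> C (Suc n)" "y = (k mod int p, a (Suc n) [^] k \<otimes> c)"
      by (auto simp: K_def \<phi>_def)
    obtain l d where l: "l mod int p = 1" "d \<in> C n" "a (Suc n) = a n [^] l \<otimes> d"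
      using step by blast
    have "d [^] k \<otimes> c \<in> C n"
      using y l C by (meson subgroup.m_closed subgroup_int_pow_closed subsetD)
    \<comment> \<open>Substituting for \<open>a (Suc n)\<close> replaces the exponent
      \<open>k\<close> by \<open>l * k\<close>, and \<open>l \<equiv> 1\<close> modulo
      \<open>p\<close> leaves the first coordinate unchanged.\<close>
    moreover have "y = \<phi> n (l * k, d [^] k \<otimes> c)"
    proof -
      have "l * k mod int p = k mod int p"
        by (metis l(1) mod_mult_left_eq mult_1)
      moreover have "a (Suc n) [^] k \<otimes> c = a n [^] (l * k) \<otimes> (d [^] k \<otimes> c)"
        using a[of n] CG y(1) l by (simp add: int_pow_distrib int_pow_pow m_ac)
      ultimately show ?thesis using y by (simp add: \<phi>_def)
    qed
    ultimately show "y \<in> K n" by (auto simp: K_def)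
  qed
  moreover have "fst ` K n = carrier (integer_mod_group p)" for n
  proof -
    have "\<one> \<in> C n" using C(1) by (rule subgroup.one_closed)
    moreover have "\<exists>k. x = k mod int p" if "0 \<le> x" "x < int p" for x
      using that by (metis mod_pos_pos_trivial)
    ultimately show ?thesis
      using p by (force simp: K_def \<phi>_def carrier_integer_mod_group)
  qed
  ultimately have "fst ` (\<Inter>n. K n) = carrier (integer_mod_group p)"
    using pc sub unfolding p_compact_def by blast
  then have "1 \<in> fst ` (\<Inter>n. K n)"
    using p by simp
  then obtain x where x: "\<And>n. (1, x) \<in> K n"
    by force
  have *: "\<exists>k c. k mod int p = 1 \<and> c \<in> C n \<and> x = a n [^] (k::int) \<otimes> c" for n
    using x[of n] by (auto simp: K_def \<phi>_def)
  moreover have "x \<in> carrier G"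
    using *[of 0] a CG by auto
  ultimately show ?thesis by blast
qed

text \<open>
  If \<open>x\<close> had infinite order, the powers \<open>x\<^bsup>q ^ n\<^esup>\<close> with \<open>q = p + 1\<close>, which are all congruent to \<open>x\<close> modulo
  \<open>p\<close>-th powers of \<open>x\<close>, would have no limit.
\<close>

lemma (in comm_group) p_compact_imp_torsion:
  assumes pc: "p_compact p G" and p: "1 < p" and x: "x \<in> carrier G"
  shows "\<exists>n>0. x [^] (n::nat) = \<one>"
proof -
  define q where "q = p + 1"
  define a where "a n = x [^] (int q ^ n)" for n
  \<comment> \<open>With trivial subgroups the limit is exact: \<open>y\<close> must be a power of
    every \<open>a n\<close>, with exponent congruent to 1 modulo \<open>p\<close> and hence
    nonzero.\<close>
  have "\<exists>y\<in>carrier G. \<forall>n. \<exists>k c. k mod int p = 1 \<and> c \<in> {\<one>} \<and> y = a n [^] (k::int) \<otimes> c"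
  proof (rule p_compact_approximation[OF pc p])
    show "subgroup {\<one>} G" by (rule triv_subgroup)
    show "a n \<in> carrier G" for n using x by (simp add: a_def)
    show "\<exists>k c. k mod int p = 1 \<and> c \<in> {\<one>} \<and> a (Suc n) = a n [^] (k::int) \<otimes> c" for n
      using x p by (intro exI[of _ "int q"] exI[of _ \<one>]) (simp add: a_def q_def int_pow_pow mult.commute)
  qed simp
  then obtain y where "\<And>n. \<exists>k. k mod int p = 1 \<and> y = a n [^] (k::int)"
    using x by (auto simp: a_def)
  then obtain k where k: "\<And>n. k n mod int p = 1" and y: "\<And>n. y = x [^] (int q ^ n * k n)"
    using x by (auto simp: a_def int_pow_pow) metis
  have k0: "k 0 \<noteq> 0" using k[of 0] by auto
  have "\<exists>n. int q ^ n * k n \<noteq> k 0"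
  proof (rule ccontr)
    assume "\<not> ?thesis"
    then have eq: "int q ^ n * k n = k 0" for n by blast
    \<comment> \<open>If all exponents agreed, the nonzero integer \<open>k 0\<close> would be
      divisible by every power of \<open>q > 1\<close>.\<close>
    have "\<bar>k 0\<bar> \<ge> int n" for n
    proof -
      have "k n \<noteq> 0" using k[of n] by auto
      then have "int q ^ n \<le> \<bar>k 0\<bar>"
        using eq[of n] by (metis abs_ge_self abs_mult dvd_imp_le_int dvd_triv_left k0 abs_of_nat of_nat_power)
      moreover have "int n < int q ^ n"
        using p by (metis less_exp of_nat_less_iff of_nat_power order_less_le_trans power_mono
            zero_le q_def add.commute one_add_one add_mono less_imp_le order_refl)
      ultimately show ?thesis by linarith
    qed
    from this[of "nat \<bar>k 0\<bar> + 1"] show False by simp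
  qed
  then obtain n where n: "int q ^ n * k n \<noteq> k 0" by blast
  have "x [^] (int q ^ n * k n) = x [^] k 0"
    using y[of n] y[of 0] by simp
  \<comment> \<open>Two distinct exponents give the same power of \<open>x\<close>. Infinite order
    is encoded as \<open>ord x = 0\<close>, which divides only 0.\<close>
  then have "int (ord x) dvd k 0 - int q ^ n * k n"
    using x by (simp add: int_pow_eq)
  then have "ord x \<noteq> 0" using n by (metis dvd_0_left_iff eq_iff_diff_eq_0 of_nat_0)
  with x show ?thesis by (intro exI[of _ "ord x"]) simp
qed

text \<open>
  Along a chain with infinitely many proper inclusions, choosing \<open>e n \<in> C n - C (Suc n)\<close> there, the infinite
  products of the \<open>e n\<close> over subsets of \<open>I\<close> would converge to uncountably many distinct limits.
\<close>

lemma (in comm_group) p_compact_dcc_exponent: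
  assumes pc: "p_compact p G" and p: "1 < p" and cnt: "countable (carrier G)"
    and C: "\<And>n. subgroup (C n) G" "\<And>n. C (Suc n) \<subseteq> C n"
    and exponent: "\<And>x. x \<in> C 0 \<Longrightarrow> x [^] p = \<one>"
  shows "\<exists>m. \<forall>n\<ge>m. C n = C m"
proof (rule ccontr)
  assume unstable: "\<not> ?thesis"
  define I where "I = {n. C (Suc n) \<noteq> C n}"
  have mono: "C n \<subseteq> C m" if "m \<le> n" for m n
    using lift_Suc_antimono_le[of C] C(2) that by blast
  have CG: "c \<in> carrier G" if "c \<in> C n" for c n
    using subgroup.subset[OF C(1)] that by blast
  have "infinite I"
  proof
    assume "finite I"
    then obtain m where m: "\<forall>n\<in>I. n < m"
      unfolding finite_nat_set_iff_bounded by (rule exE)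
    have eq: "C n = C m" if "m \<le> n" for n
      using that
    proof (induction n rule: dec_induct)
      case (step n)
      have "n \<notin> I" using m step(1) by auto
      then have "C (Suc n) = C n" by (simp add: I_def)
      also have "\<dots> = C m" by (rule step)
      finally show ?case .
    qed simp
    have "\<exists>m. \<forall>n\<ge>m. C n = C m"
      by (intro exI[of _ m] allI impI) (rule eq)
    with unstable show False by (rule notE)
  qed
  have "\<exists>e. e \<in> C n \<and> (n \<in> I \<longrightarrow> e \<notin> C (Suc n))" for n
    using C(2)[of n] subgroup.one_closed[OF C(1), of n] by (cases "n \<in> I") (auto simp: I_def)
  then obtain e where e: "\<And>n. e n \<in> C n" "\<And>n. n \<in> I \<Longrightarrow> e n \<notin> C (Suc n)"
    by metis
  \<comment> \<open>\<open>a \<epsilon> n\<close> is the product of the \<open>e i\<close> with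
    \<open>i \<in> \<epsilon>\<close> and \<open>i < n\<close>.\<close>
  define a where "a \<epsilon> = rec_nat \<one> (\<lambda>n r. if n \<in> \<epsilon> then r \<otimes> e n else r)" for \<epsilon> :: "nat set"
  have a0: "a \<epsilon> 0 = \<one>" and aS: "a \<epsilon> (Suc n) = (if n \<in> \<epsilon> then a \<epsilon> n \<otimes> e n else a \<epsilon> n)" for \<epsilon> n
    by (simp_all add: a_def)
  have aC: "a \<epsilon> n \<in> C 0" for \<epsilon> n
  proof (induction n)
    case (Suc n)
    moreover have "e n \<in> C 0" using e(1)[of n] mono[of 0 n] by blast
    ultimately show ?case using C(1)[of 0] by (simp add: aS subgroup.m_closed)
  qed (use C(1)[of 0] in \<open>simp add: a0 subgroup.one_closed\<close>)
  \<comment> \<open>On \<open>C 0\<close>, of exponent \<open>p\<close>, the exponents congruent to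
    1 supplied by the approximation lemma have no effect, so the limit is a genuine one modulo each
    \<open>C n\<close>.\<close>
  have pow: "y [^] k = y" if "y \<in> C 0" "k mod int p = 1" for y k
  proof -
    have y: "y \<in> carrier G" using that(1) by (rule CG)
    have "k = int p * (k div int p) + 1"
      using that(2) by (metis mult_div_mod_eq)
    then have "y [^] k = (y [^] int p) [^] (k div int p) \<otimes> y"
      using y int_pow_mult[OF y] int_pow_pow[OF y] by (metis int_pow_1)
    then show ?thesis
      using y exponent[OF that(1)] by (simp add: int_pow_int)
  qed
  have "\<exists>x\<in>carrier G. \<forall>n. \<exists>c\<in>C n. x = a \<epsilon> n \<otimes> c" for \<epsilon>
  proof -
    have "\<exists>x\<in>carrier G. \<forall>n. \<exists>k c. k mod int p = 1 \<and> c \<in> C n \<and> x = a \<epsilon> n [^] (k::int) \<otimes> c"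
    proof (rule p_compact_approximation[where C = C, OF pc p C])
      show "a \<epsilon> n \<in> carrier G" for n using aC by (rule CG)
      show "\<exists>k c. k mod int p = 1 \<and> c \<in> C n \<and> a \<epsilon> (Suc n) = a \<epsilon> n [^] (k::int) \<otimes> c" for n
        using p e(1)[of n] C(1) aC[of \<epsilon> n] CG[OF aC]
        by (intro exI[of _ 1] exI[of _ "if n \<in> \<epsilon> then e n else \<one>"])
           (auto simp: aS subgroup.one_closed)
    qed
    then show ?thesis using pow[OF aC] by metis
  qed
  then obtain x where x: "\<And>\<epsilon>. x \<epsilon> \<in> carrier G" "\<And>\<epsilon> n. \<exists>c\<in>C n. x \<epsilon> = a \<epsilon> n \<otimes> c"
    by metis
  \<comment> \<open>At the first index \<open>n\<close> where the two subsets differ, the partial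
    products differ by \<open>e n\<close> modulo \<open>C (Suc n)\<close>; equal limits would force
    \<open>e n\<close> into \<open>C (Suc n)\<close>.\<close>
  have ne: "x \<epsilon> \<noteq> x \<delta>" if sub: "\<epsilon> \<subseteq> I" and n: "n \<in> \<epsilon>" "n \<notin> \<delta>" and below: "\<And>i. i < n \<Longrightarrow> i \<in> \<epsilon> \<longleftrightarrow> i \<in> \<delta>"
    for \<epsilon> \<delta> n
  proof
    assume eq: "x \<epsilon> = x \<delta>"
    have "a \<epsilon> i = a \<delta> i" if "i \<le> n" for i
      using that by (induction i) (auto simp: a0 aS below)
    then have an: "a \<epsilon> n = a \<delta> n" by simp
    obtain c d where "c \<in> C (Suc n)" "d \<in> C (Suc n)" "a \<epsilon> (Suc n) \<otimes> c = a \<delta> (Suc n) \<otimes> d"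
      using x(2) eq by metis
    moreover from this have G: "c \<in> carrier G" "d \<in> carrier G" "e n \<in> carrier G"
      using CG e(1) by blast+
    ultimately have "a \<delta> n \<otimes> (e n \<otimes> c) = a \<delta> n \<otimes> d"
      using n an CG[OF aC] by (simp add: aS m_assoc)
    then have "e n \<otimes> c = d"
      using G CG[OF aC] by simp
    then have "e n = d \<otimes> inv c"
      using G by (simp add: inv_solve_right)
    then have "e n \<in> C (Suc n)"
      using \<open>c \<in> C (Suc n)\<close> \<open>d \<in> C (Suc n)\<close> C(1) by (simp add: subgroup.m_closed subgroup.m_inv_closed)
    then show False using e(2) sub n(1) by blast
  qed
  have "inj_on x (Pow I)"
  proof (rule inj_onI, rule ccontr)
    fix \<epsilon> \<delta> assume *: "\<epsilon> \<in> Pow I" "\<delta> \<in> Pow I" "x \<epsilon> = x \<delta>" "\<epsilon> \<noteq> \<delta>"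
    then have ex: "\<exists>n. (n \<in> \<epsilon>) \<noteq> (n \<in> \<delta>)" by blast
    define n where "n = (LEAST n. (n \<in> \<epsilon>) \<noteq> (n \<in> \<delta>))"
    have "(n \<in> \<epsilon>) \<noteq> (n \<in> \<delta>)" "\<And>i. i < n \<Longrightarrow> i \<in> \<epsilon> \<longleftrightarrow> i \<in> \<delta>"
      using LeastI_ex[OF ex] not_less_Least unfolding n_def by blast+
    then show False using ne[of \<epsilon> n \<delta>] ne[of \<delta> n \<epsilon>] * by auto
  qed
  moreover have "x ` Pow I \<subseteq> carrier G" using x(1) by blast
  ultimately have "countable (Pow I)"
    using cnt countable_subset countable_image_inj_on by metis
  \<comment> \<open>A countable power set of the infinite set \<open>I\<close> of naturals would be
    an image of \<open>I\<close> itself, against Cantor.\<close>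
  then have "\<exists>f. f ` I = Pow I"
    using \<open>infinite I\<close> bij_betw_from_nat_into[of "Pow I"] to_nat_on_infinite[of I]
    by (metis bij_betw_imp_surj_on countableI_type finite_Pow_iff image_comp)
  then show False using Cantors_theorem by blast
qed

text \<open>Reduction to exponent \<open>p\<close>: chains built from the subgroups
  \<open>S j k\<close> below become constant by the previous lemma. Once every row
  \<open>S j\<close> is constant from one common index \<open>m\<close> on, elements of
  \<open>L m\<close> are moved into \<open>L n\<close> by induction on the power of \<open>p\<close>
  that kills them.\<close>

lemma (in comm_group) p_compact_dcc_primary:
  assumes pc: "p_compact p G" and p: "1 < p" and cnt: "countable (carrier G)"
    and L: "\<And>n. subgroup (L n) G" "\<And>n. L (Suc n) \<subseteq> L n"
    and primary: "\<And>x. x \<in> L 0 \<Longrightarrow> \<exists>j. x [^] (p ^ j) = \<one>"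
  shows "\<exists>m. \<forall>n\<ge>m. L n = L m"
proof -
  have LG: "c \<in> carrier G" if "c \<in> L n" for c n
    using subgroup.subset[OF L(1)] that by blast
  have mono: "L n \<subseteq> L m" if "m \<le> n" for m n
    using lift_Suc_antimono_le[of L] L(2) that by blast
  \<comment> \<open>The traces of \<open>(L k)\<^bsup>p ^ j\<^esup>\<close> on the elements of exponent \<open>p\<close> determine \<open>L k\<close>.\<close>
  define S where "S j k = {y. y [^] p = \<one> \<and> (\<exists>x\<in>L k. y = x [^] (p ^ j))}" for j k :: nat
  have S_mono: "S j' k' \<subseteq> S j k" if "j \<le> j'" "k \<le> k'" for j j' k k'
  proof
    fix y assume "y \<in> S j' k'"
    then obtain x where x: "y [^] p = \<one>" "x \<in> L k'" "y = x [^] (p ^ j')" by (auto simp: S_def)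
    obtain d where d: "j' = d + j" using \<open>j \<le> j'\<close> le_Suc_ex by (metis add.commute)
    have "y = (x [^] (p ^ d)) [^] (p ^ j)"
      using x(2,3) LG by (simp add: d nat_pow_pow power_add)
    moreover have "x [^] (p ^ d) \<in> L k"
      using x(2) mono[OF \<open>k \<le> k'\<close>] subgroup_int_pow_closed[OF L(1)]
      by (metis int_pow_int subsetD)
    ultimately show "y \<in> S j k" using x(1) by (auto simp: S_def)
  qed
  have S_sub: "subgroup (S j k) G" for j k
  proof (rule subgroupI)
    show "S j k \<subseteq> carrier G" using LG by (auto simp: S_def)
    have "\<one> \<in> S j k" using subgroup.one_closed[OF L(1), of k] by (force simp: S_def)
    then show "S j k \<noteq> {}" by blast
    show "inv y \<in> S j k" if "y \<in> S j k" for y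
      using that LG L(1) by (auto simp: S_def nat_pow_inv intro!: bexI[of _ "inv _"] subgroup.m_inv_closed)
    show "y \<otimes> z \<in> S j k" if yz: "y \<in> S j k" "z \<in> S j k" for y z
    proof -
      obtain u v where "u \<in> L k" "v \<in> L k" "y = u [^] (p ^ j)" "z = v [^] (p ^ j)" "y [^] p = \<one>" "z [^] p = \<one>"
        using yz by (auto simp: S_def)
      then show ?thesis
        using LG L(1) unfolding S_def
        by (auto simp: pow_mult_distrib m_comm intro!: bexI[of _ "u \<otimes> v"] subgroup.m_closed)
    qed
  qed
  have dcc: "\<exists>m. \<forall>n\<ge>m. S (f n) n = S (f m) m" if "\<And>n. f n \<le> f (Suc n)" for f
    using that by (intro p_compact_dcc_exponent[OF pc p cnt] S_sub S_mono) (auto simp: S_def)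
  \<comment> \<open>The diagonal chain stabilises; this controls all rows beyond \<open>n0\<close>
    at once.\<close>
  obtain n0 where n0: "\<And>n. n \<ge> n0 \<Longrightarrow> S n n = S n0 n0"
    using dcc[of "\<lambda>n. n"] by auto
  have "\<exists>m. \<forall>n\<ge>m. S j n = S j m" for j
    using dcc[of "\<lambda>_. j"] by auto
  then obtain N where N: "\<And>j n. n \<ge> N j \<Longrightarrow> S j n = S j (N j)"
    by metis
  \<comment> \<open>Only the finitely many rows up to \<open>n0\<close> need their own bound; a
    later row is squeezed between two terms of the constant part of the diagonal.\<close>
  define m where "m = Max (insert n0 (N ` {..n0}))"
  have m: "n0 \<le> m" "\<And>j. j \<le> n0 \<Longrightarrow> N j \<le> m"
    unfolding m_def by (rule Max_ge; simp)+
  have S_eq: "S j m \<subseteq> S j n" if "m \<le> n" for j n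
  proof (cases "j \<le> n0")
    case True
    then show ?thesis using N[of j m] N[of j n] m(2)[of j] that by simp
  next
    case False
    have "S j m \<subseteq> S n0 n0" using False m by (intro S_mono) auto
    also have "\<dots> = S (max j n) (max j n)" using False by (intro n0[symmetric]) auto
    also have "\<dots> \<subseteq> S j n" by (intro S_mono) auto
    finally show ?thesis .
  qed
  have "L n = L m" if "m \<le> n" for n
  proof
    \<comment> \<open>If \<open>p ^ Suc j\<close> kills \<open>b\<close>, then
      \<open>b [^] (p ^ j)\<close> has exponent \<open>p\<close>, so it equals
      \<open>c [^] (p ^ j)\<close> for some \<open>c \<in> L n\<close>. The quotient of
      \<open>b\<close> by \<open>c\<close> is killed by \<open>p ^ j\<close>, and induction applies
      to it.\<close>
    have "b \<in> L n" if "b \<in> L m" "b [^] (p ^ j) = \<one>" for b j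
      using that
    proof (induction j arbitrary: b)
      case 0
      then show ?case using LG L(1) by (simp add: subgroup.one_closed)
    next
      case (Suc j)
      have bG: "b \<in> carrier G" using Suc.prems LG by blast
      have "b [^] (p ^ j) \<in> S j m"
        using Suc.prems bG by (auto simp: S_def nat_pow_pow mult.commute)
      then have "b [^] (p ^ j) \<in> S j n"
        using S_eq[OF \<open>m \<le> n\<close>] by blast
      then obtain c where c: "c \<in> L n" "b [^] (p ^ j) = c [^] (p ^ j)"
        by (auto simp: S_def)
      have cG: "c \<in> carrier G" using c LG by blast
      have "b \<otimes> inv c \<in> L m"
        using Suc.prems(1) c(1) mono[OF \<open>m \<le> n\<close>] L(1)
        by (meson subgroup.m_closed subgroup.m_inv_closed subsetD)
      moreover have "(b \<otimes> inv c) [^] (p ^ j) = \<one>"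
        using bG cG c(2) by (simp add: pow_mult_distrib m_comm nat_pow_inv)
      ultimately have "b \<otimes> inv c \<in> L n" by (rule Suc.IH)
      then have "b \<otimes> inv c \<otimes> c \<in> L n" using c(1) L(1) by (simp add: subgroup.m_closed)
      then show ?case using bG cG by (simp add: m_assoc)
    qed
    then show "L m \<subseteq> L n" using primary mono[of 0 m] by blast
  qed (rule mono[OF that])
  then show ?thesis by blast
qed

section \<open>Lifting through a decreasing sequence of subgroups\<close>

text \<open>\<open>r\<close> is the part of \<open>n\<close> prime to \<open>p\<close>. The Bezout
  relation is given for every power of \<open>p\<close>, because in \<open>p_compact_lift\<close>
  that power comes from an element and \<open>r\<close> from the order of one of its
  preimages.\<close>

lemma prime_power_decomposition:
  fixes p n :: nat
  assumes "prime p" "0 < n"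
  obtains j r where "n = p ^ j * r" "0 < r" "p dvd n \<Longrightarrow> r < n"
    "\<And>i. \<exists>u v. int (p ^ i) * u + int r * v = 1"
proof -
  obtain r where r: "n = p ^ multiplicity p n * r" "\<not> p dvd r"
    using multiplicity_decompose'[of n p] assms not_prime_unit by blast
  have "\<exists>u v. int (p ^ i) * u + int r * v = 1" for i
  proof -
    have "coprime (int (p ^ i)) (int r)"
      using r(2) assms(1) by (simp add: prime_imp_coprime)
    then show ?thesis
      using bezout_int[of "int (p ^ i)" "int r"] by (metis coprime_iff_gcd_eq_1 mult.commute)
  qed
  moreover have "0 < r" using r assms(2) by (intro Nat.gr0I) auto
  moreover have "r < n" if "p dvd n"
  proof -
    have "multiplicity p n \<noteq> 0" using that r by (metis mult_1 power_0)
    then have "1 < p ^ multiplicity p n" using one_less_power[OF prime_gt_1_nat[OF assms(1)]] by blast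
    then have "1 * r < p ^ multiplicity p n * r" using \<open>0 < r\<close> by (intro mult_strict_right_mono) auto
    then show ?thesis using r(1) by simp
  qed
  ultimately show ?thesis using that r(1) by blast
qed

lemma (in comm_group) subgroup_is_comm_group:
  assumes "subgroup A G"
  shows "comm_group (G\<lparr>carrier := A\<rparr>)"
  using subgroup.subset[OF assms]
  by (intro group.group_comm_groupI subgroup.subgroup_is_group[OF assms is_group])
     (auto intro: m_comm)

text \<open>For a point of p-power order in all images, preimages of p-power order can be chosen in
  each \<open>L n\<close>. Two of them differ by a p-primary element of the kernel, and those
  elements satisfy the descending chain condition, so one preimage serves for all \<open>n\<close>.
  Primary decomposition handles the other points.\<close>

lemma (in comm_group) p_compact_lift:
  assumes Q: "group Q" and \<pi>: "\<pi> \<in> hom G Q"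
    and A: "subgroup A G" "countable A" "\<And>p. prime p \<Longrightarrow> p_compact p (G\<lparr>carrier := A\<rparr>)"
    and L: "\<And>n. subgroup (L n) G" "\<And>n. L (Suc n) \<subseteq> L n"
    and torsion: "\<And>x. x \<in> L 0 \<Longrightarrow> \<exists>k>0. x [^] (k::nat) = \<one>"
    and kernel: "\<And>x. x \<in> L 0 \<Longrightarrow> \<pi> x = \<one>\<^bsub>Q\<^esub> \<Longrightarrow> x \<in> A"
  shows "(\<Inter>n. \<pi> ` L n) \<subseteq> \<pi> ` (\<Inter>n. L n)"
proof -
  interpret Q: group Q by (rule Q)
  interpret \<pi>: group_hom G Q \<pi> by unfold_locales (rule \<pi>)
  have mono: "L n \<subseteq> L m" if "m \<le> n" for m n
    using lift_Suc_antimono_le[of L] L(2) that by blast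
  have LG: "x \<in> carrier G" if "x \<in> L n" for x n
    using subgroup.subset[OF L(1)] that by blast
  define R where "R = (\<Inter>n. \<pi> ` L n)"
  define R' where "R' = \<pi> ` (\<Inter>n. L n)"
  have R: "subgroup R Q"
    unfolding R_def using L(1) by (intro Q.subgroups_Inter) (auto intro: \<pi>.subgroup_img_is_subgroup)
  have R': "subgroup R' Q"
    unfolding R'_def using L(1) by (intro \<pi>.subgroup_img_is_subgroup subgroups_Inter) auto
  have RQ: "s \<in> carrier Q" if "s \<in> R" for s
    using subgroup.subset[OF R] that by blast

  have primary: "s \<in> R'" if s: "s \<in> R" "s [^]\<^bsub>Q\<^esub> (p ^ j) = \<one>\<^bsub>Q\<^esub>" and p: "prime p" for s and p j :: nat
  proof -
    have "\<exists>x. x \<in> L n \<and> \<pi> x = s \<and> (\<exists>i. x [^] (p ^ i) = \<one>)" for n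
    proof -
      obtain y where y: "y \<in> L n" "\<pi> y = s"
        using s(1) by (auto simp: R_def)
      obtain k :: nat where k: "0 < k" "y [^] k = \<one>"
        using torsion y(1) mono[of 0 n] by blast
      obtain i r :: nat and u v where d: "k = p ^ i * r" "int (p ^ j) * u + int r * v = 1"
        using prime_power_decomposition[OF p k(1)] by metis
      have yG: "y \<in> carrier G" using y(1) by (rule LG)
      \<comment> \<open>Since \<open>r * v \<equiv> 1\<close> modulo \<open>p ^ j\<close>, this
        power still maps to \<open>s\<close>; the factor \<open>r\<close> removes the part of the
        order of \<open>y\<close> prime to \<open>p\<close>.\<close>
      let ?x = "y [^] (int r * v)"
      have "?x \<in> L n" using subgroup_int_pow_closed[OF L(1) y(1)] .
      moreover have "\<pi> ?x = s"
      proof -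
        have "s = s [^]\<^bsub>Q\<^esub> (int (p ^ j) * u + int r * v)"
          unfolding d(2) using RQ[OF s(1)] by simp
        also have "\<dots> = (s [^]\<^bsub>Q\<^esub> int (p ^ j)) [^]\<^bsub>Q\<^esub> u \<otimes>\<^bsub>Q\<^esub> s [^]\<^bsub>Q\<^esub> (int r * v)"
          using RQ[OF s(1)] by (simp only: Q.int_pow_mult Q.int_pow_pow)
        also have "\<dots> = s [^]\<^bsub>Q\<^esub> (int r * v)"
          unfolding int_pow_int s(2) using RQ[OF s(1)] by simp
        finally show ?thesis using yG y(2) by (simp add: \<pi>.hom_int_pow)
      qed
      moreover have "?x [^] (p ^ i) = \<one>"
      proof -
        have "?x [^] int (p ^ i) = (y [^] int k) [^] v"
          using yG by (simp only: int_pow_pow d(1)) (simp add: mult_ac)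
        also have "\<dots> = \<one>" using k(2) by (simp only: int_pow_int int_pow_one)
        finally show ?thesis by (simp only: int_pow_int)
      qed
      ultimately show ?thesis by blast
    qed
    then obtain x where x: "\<And>n. x n \<in> L n" "\<And>n. \<pi> (x n) = s" "\<And>n. \<exists>i. x n [^] (p ^ i) = \<one>"
      by metis
    \<comment> \<open>The p-primary part of the kernel of \<open>\<pi>\<close> on
      \<open>L n\<close>: a decreasing sequence of subgroups of \<open>A\<close>, hence eventually
      constant.\<close>
    define B where "B n = {b \<in> L n. \<pi> b = \<one>\<^bsub>Q\<^esub> \<and> (\<exists>i. b [^] (p ^ i) = \<one>)}" for n
    have mult: "\<exists>i. (b \<otimes> c) [^] (p ^ i) = \<one>"
      if bc: "b \<in> carrier G" "c \<in> carrier G" "\<exists>i. b [^] (p ^ i) = \<one>" "\<exists>i. c [^] (p ^ i) = \<one>" for b c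
    proof -
      obtain i i' where "b [^] (p ^ i) = \<one>" "c [^] (p ^ i') = \<one>" using bc by blast
      then have "b [^] (p ^ i * p ^ i') = \<one>" "c [^] (p ^ i' * p ^ i) = \<one>"
        using that by (metis nat_pow_pow nat_pow_one)+
      then have "(b \<otimes> c) [^] (p ^ (i + i')) = \<one>"
        using that by (simp add: pow_mult_distrib m_comm power_add mult.commute)
      then show ?thesis by blast
    qed
    have inv: "\<exists>i. (inv b) [^] (p ^ i) = \<one>"
      if "b \<in> carrier G" "\<exists>i. b [^] (p ^ i) = \<one>" for b
      using that by (metis inv_one nat_pow_inv)
    have B: "subgroup (B n) G" for n
    proof (rule subgroupI)
      show "B n \<subseteq> carrier G" using LG by (auto simp: B_def)
      have "\<one> \<in> B n" using subgroup.one_closed[OF L(1)] by (auto simp: B_def)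
      then show "B n \<noteq> {}" by blast
      show "inv b \<in> B n" if b: "b \<in> B n" for b
      proof -
        have "b \<in> carrier G" using b LG by (auto simp: B_def)
        then show ?thesis
          using b L(1)[of n] inv[of b] by (auto simp: B_def subgroup.m_inv_closed)
      qed
      show "b \<otimes> c \<in> B n" if bc: "b \<in> B n" "c \<in> B n" for b c
      proof -
        have "b \<in> carrier G" "c \<in> carrier G" using bc LG by (auto simp: B_def)
        then show ?thesis
          using bc L(1)[of n] mult[of b c] by (auto simp: B_def subgroup.m_closed)
      qed
    qed
    have BA: "B n \<subseteq> A" for n
      using kernel mono[of 0 n] by (auto simp: B_def)
    interpret A: comm_group "G\<lparr>carrier := A\<rparr>"
      using A(1) by (rule subgroup_is_comm_group)
    have "\<exists>m. \<forall>n\<ge>m. B n = B m"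
    proof (rule A.p_compact_dcc_primary[where L = B])
      show "p_compact p (G\<lparr>carrier := A\<rparr>)" using A(3) p .
      show "1 < p" using p by (rule prime_gt_1_nat)
      show "subgroup (B n) (G\<lparr>carrier := A\<rparr>)" for n using B A(1) BA by (rule subgroup_incl)
      show "B (Suc n) \<subseteq> B n" for n using L(2)[of n] by (auto simp: B_def)
      show "\<exists>j. x [^]\<^bsub>G\<lparr>carrier := A\<rparr>\<^esub> p ^ j = \<one>\<^bsub>G\<lparr>carrier := A\<rparr>\<^esub>" if "x \<in> B 0" for x
        using that by (simp add: B_def flip: nat_pow_consistent)
    qed (simp add: A(2))
    then obtain m where m: "\<And>n. m \<le> n \<Longrightarrow> B n = B m" by blast
    \<comment> \<open>For \<open>n > m\<close> both \<open>x n\<close> and \<open>x m\<close> lie in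
      \<open>L m\<close> over \<open>s\<close> and have p-power order, so their quotient is in
      \<open>B m = B n\<close>, inside \<open>L n\<close>.\<close>
    have "x m \<in> L n" for n
    proof (cases "n \<le> m")
      case True
      then show ?thesis using x(1)[of m] mono by blast
    next
      case False
      have G: "x n \<in> carrier G" "x m \<in> carrier G" using x(1) LG by blast+
      have "x n \<in> L m" using False x(1)[of n] mono[of m n] by auto
      then have "x n \<otimes> inv x m \<in> B m"
        using x(1)[of m] x(2)[of m] x(2)[of n] G L(1)[of m] mult[OF G(1) inv_closed x(3) inv[OF _ x(3)]]
        by (auto simp: B_def subgroup.m_closed subgroup.m_inv_closed)
      then have "x n \<otimes> inv x m \<in> L n" using m[of n] False by (auto simp: B_def)
      then have "inv (x n \<otimes> inv x m) \<otimes> x n \<in> L n"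
        using L(1)[of n] x(1)[of n] by (simp add: subgroup.m_closed subgroup.m_inv_closed)
      moreover have "inv (x n \<otimes> inv x m) \<otimes> x n = x m"
        using G by (simp add: inv_mult_group m_assoc)
      ultimately show ?thesis by simp
    qed
    then show ?thesis using x(2)[of m] by (auto simp: R'_def)
  qed

  \<comment> \<open>Induction on an exponent killing \<open>s\<close>: with
    \<open>k = p ^ j * r\<close>, the element \<open>s [^] (p ^ j)\<close> is killed by the smaller
    \<open>r\<close>, and \<open>s [^] r\<close> by \<open>p ^ j\<close>; the Bezout relation
    recombines \<open>s\<close> from them.\<close>
  have "s \<in> R'" if "s \<in> R" "0 < k" "s [^]\<^bsub>Q\<^esub> (k::nat) = \<one>\<^bsub>Q\<^esub>" for s k
    using that
  proof (induction k arbitrary: s rule: less_induct)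
    case (less k)
    note sQ = RQ[OF less.prems(1)]
    show ?case
    proof (cases "k = 1")
      case True
      then show ?thesis using less.prems sQ R' by (simp add: subgroup.one_closed)
    next
      case False
      then obtain p where p: "prime p" "p dvd k" using prime_factor_nat by blast
      obtain j r :: nat and u v where d: "k = p ^ j * r" "0 < r" "r < k" "int (p ^ j) * u + int r * v = 1"
        using prime_power_decomposition[OF p(1) less.prems(2)] p(2) by metis
      have "s [^]\<^bsub>Q\<^esub> (p ^ j) \<in> R'"
      proof (rule less.IH[OF d(3)])
        show "s [^]\<^bsub>Q\<^esub> (p ^ j) \<in> R"
          using Q.subgroup_int_pow_closed[OF R less.prems(1)] by (metis int_pow_int)
        show "(s [^]\<^bsub>Q\<^esub> (p ^ j)) [^]\<^bsub>Q\<^esub> r = \<one>\<^bsub>Q\<^esub>"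
          using less.prems(3) sQ by (simp add: Q.nat_pow_pow d(1))
      qed (rule d(2))
      moreover have "s [^]\<^bsub>Q\<^esub> r \<in> R'"
      proof (rule primary[OF _ _ p(1)])
        show "s [^]\<^bsub>Q\<^esub> r \<in> R"
          using Q.subgroup_int_pow_closed[OF R less.prems(1)] by (metis int_pow_int)
        show "(s [^]\<^bsub>Q\<^esub> r) [^]\<^bsub>Q\<^esub> (p ^ j) = \<one>\<^bsub>Q\<^esub>"
          using less.prems(3) sQ by (simp add: Q.nat_pow_pow d(1) mult.commute)
      qed
      ultimately have "(s [^]\<^bsub>Q\<^esub> (p ^ j)) [^]\<^bsub>Q\<^esub> u \<otimes>\<^bsub>Q\<^esub> (s [^]\<^bsub>Q\<^esub> r) [^]\<^bsub>Q\<^esub> v \<in> R'"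
        using R' by (intro subgroup.m_closed[OF R'] Q.subgroup_int_pow_closed[OF R'])
      moreover have "(s [^]\<^bsub>Q\<^esub> (p ^ j)) [^]\<^bsub>Q\<^esub> u \<otimes>\<^bsub>Q\<^esub> (s [^]\<^bsub>Q\<^esub> r) [^]\<^bsub>Q\<^esub> v
          = s [^]\<^bsub>Q\<^esub> (int (p ^ j) * u + int r * v)"
        using sQ by (simp only: Q.int_pow_mult flip: Q.int_pow_pow int_pow_int)
      ultimately show ?thesis using sQ d(4) by simp
    qed
  qed
  moreover have "\<exists>k>0. s [^]\<^bsub>Q\<^esub> (k::nat) = \<one>\<^bsub>Q\<^esub>" if s: "s \<in> R" for s
  proof -
    obtain x where "x \<in> L 0" "s = \<pi> x" using s by (auto simp: R_def)
    then show ?thesis using torsion[of x] LG by (metis \<pi>.hom_nat_pow \<pi>.hom_one)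
  qed
  ultimately have "R \<subseteq> R'" by blast
  then show ?thesis unfolding R_def R'_def .
qed

section \<open>Levels of the tree of \<open>G\<close>\<close>

text \<open>Pushing the subgroups forward to \<open>\<Delta>\<close> keeps them decreasing and onto
  Z(p). A point common to the images has a preimage in each \<open>K n\<close>, and injectivity
  makes all these preimages equal. This carries p-compactness from the filtration quotients to the
  groups \<open>A m\<close>.\<close>

lemma p_compact_inj_hom:
  assumes gr: "group \<Gamma>" "group \<Delta>" and f: "f \<in> hom \<Gamma> \<Delta>" "inj_on f (carrier \<Gamma>)"
    and pc: "p_compact p \<Delta>"
  shows "p_compact p \<Gamma>"
  unfolding p_compact_def
proof (intro allI impI, elim conjE)
  fix K :: "nat \<Rightarrow> (int \<times> 'a) set"
  let ?Z = "integer_mod_group p"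
  assume K: "\<forall>n. subgroup (K n) (?Z \<times>\<times> \<Gamma>)" "decseq K" "\<forall>n. fst ` K n = carrier ?Z"
  interpret F: group_hom "?Z \<times>\<times> \<Gamma>" "?Z \<times>\<times> \<Delta>" "map_prod id f"
    using f(1) gr
    by (intro group_hom.intro group_hom_axioms.intro homI)
       (auto simp: DirProd_group hom_def Pi_iff)
  define K' where "K' n = map_prod id f ` K n" for n
  have "\<forall>n. subgroup (K' n) (?Z \<times>\<times> \<Delta>)"
    using K(1) by (auto simp: K'_def intro: F.subgroup_img_is_subgroup)
  moreover have "decseq K'"
    using K(2) unfolding decseq_def K'_def by blast
  moreover have "\<forall>n. fst ` K' n = carrier ?Z"
    using K(3) by (simp add: K'_def image_image)
  ultimately have *: "fst ` (\<Inter>n. K' n) = carrier ?Z"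
    using pc unfolding p_compact_def by blast
  show "fst ` (\<Inter>n. K n) = carrier ?Z"
  proof
    show "fst ` (\<Inter>n. K n) \<subseteq> carrier ?Z"
      using K(3) by blast
    show "carrier ?Z \<subseteq> fst ` (\<Inter>n. K n)"
    proof
      fix i assume "i \<in> carrier ?Z"
      then obtain y where y: "\<And>n. (i, y) \<in> K' n"
        using * by force
      have "\<exists>x. (i, x) \<in> K n \<and> f x = y" for n
      proof -
        have "(i, y) \<in> map_prod id f ` K n" using y[of n] unfolding K'_def .
        then show ?thesis by auto
      qed
      then obtain x where x: "\<And>n. (i, x n) \<in> K n" "\<And>n. f (x n) = y"
        by metis
      have "x n \<in> carrier \<Gamma>" for n
        using x(1)[of n] K(1) subgroup.subset by fastforce
      then have "x n = x 0" for n
        using x(2) f(2) by (metis inj_onD)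
      then have "(i, x 0) \<in> (\<Inter>n. K n)"
        using x(1) by (metis INT_I)
      then show "i \<in> fst ` (\<Inter>n. K n)" by force
    qed
  qed
qed

lemma one_fin_product: "\<one>\<^bsub>fin_product H n\<^esub> = map (\<lambda>i. \<one>\<^bsub>H i\<^esub>) [0..<n]"
proof -
  have "\<one>\<^bsub>DirProd_list Gs\<^esub> = map one Gs" for Gs :: "('a, 'b) monoid_scheme list"
    by (induction Gs) (simp_all add: DirProd_list_one)
  then show ?thesis by (simp add: fin_product_def comp_def)
qed

lemma full_tree_iff: "\<sigma> \<in> full_tree H \<longleftrightarrow> \<sigma> \<noteq> [] \<and> \<sigma> \<in> carrier (fin_product H (length \<sigma>))"
  by (auto simp: full_tree_def carrier_fin_product Suc_le_eq intro!: bexI[of _ "length \<sigma>"])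

section \<open>Finite levels, restriction maps and their kernels\<close>

locale p_compact_filtration =
  fixes H :: "nat \<Rightarrow> ('a, 'b) monoid_scheme" and G :: "(nat \<Rightarrow> 'a) set"
  assumes comm_group_H: "\<And>n. comm_group (H n)"
    and countable_H: "\<And>n. countable (carrier (H n))"
    and subgroup_G: "subgroup G (product_group UNIV H)"
    and p_compact_quotient: "\<And>p n. prime p \<Longrightarrow> p_compact p (filtration_quotient H G n)"
begin

abbreviation F where "F \<equiv> fin_product H"

abbreviation P where "P \<equiv> product_group UNIV H"

definition res :: "nat \<Rightarrow> (nat \<Rightarrow> 'a) \<Rightarrow> 'a list" where
  "res m x = map x [0..<m]"

text \<open>For \<open>m \<ge> 1\<close> this is a level of \<open>tree_of H G\<close>.
  \<open>T 0\<close> is the trivial group consisting of \<open>[]\<close>, which lies outside the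
  tree but starts the induction over levels; accordingly \<open>A 0 = T 1\<close>.\<close>

definition T :: "nat \<Rightarrow> 'a list set" where
  "T m = res m ` G"

definition A :: "nat \<Rightarrow> 'a list set" where
  "A m = {\<sigma> \<in> T (Suc m). take m \<sigma> = \<one>\<^bsub>F m\<^esub>}"

lemma group_H: "group (H n)"
  using comm_group_H by (rule comm_group.axioms)

lemma comm_group_F: "comm_group (F m)"
proof (rule group.group_comm_groupI)
  show "group (F m)"
    unfolding fin_product_def by (rule DirProd_list_is_group) (simp add: group_H)
  show "x \<otimes>\<^bsub>F m\<^esub> y = y \<otimes>\<^bsub>F m\<^esub> x" if "x \<in> carrier (F m)" "y \<in> carrier (F m)" for x y
    using that comm_group_H
    by (auto simp: mult_fin_product carrier_fin_product comm_groupE(4))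
qed

lemma group_F: "group (F m)"
  using comm_group_F by (rule comm_group.axioms)

lemma group_P: "group P"
  by (simp add: group_H)

lemma group_hom_take:
  assumes "m \<le> n"
  shows "group_hom (F n) (F m) (take m)"
proof (intro group_hom.intro group_hom_axioms.intro homI group_F)
  show "take m x \<in> carrier (F m)" if "x \<in> carrier (F n)" for x
    using that assms by (auto simp: carrier_fin_product)
  then show "take m (x \<otimes>\<^bsub>F n\<^esub> y) = take m x \<otimes>\<^bsub>F m\<^esub> take m y"
    if "x \<in> carrier (F n)" "y \<in> carrier (F n)" for x y
    using that assms by (simp add: mult_fin_product take_map)
qed

lemma group_hom_res: "group_hom P (F m) (res m)"
proof (intro group_hom.intro group_hom_axioms.intro homI group_F group_P)
  show res: "res m x \<in> carrier (F m)" if "x \<in> carrier P" for x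
    using that by (auto simp: carrier_fin_product res_def)
  show "res m (x \<otimes>\<^bsub>P\<^esub> y) = res m x \<otimes>\<^bsub>F m\<^esub> res m y"
    if "x \<in> carrier P" "y \<in> carrier P" for x y
    using res[OF that(1)] res[OF that(2)] by (simp add: mult_fin_product) (simp add: res_def)
qed

lemma take_res: "m \<le> n \<Longrightarrow> take m (res n x) = res m x"
  by (simp add: res_def take_map)

lemma subgroup_T: "subgroup (T m) (F m)"
  unfolding T_def by (rule group_hom.subgroup_img_is_subgroup[OF group_hom_res subgroup_G])

lemma T_subset: "T m \<subseteq> carrier (F m)"
  using subgroup_T by (rule subgroup.subset)

lemma take_T: "\<sigma> \<in> T n \<Longrightarrow> m \<le> n \<Longrightarrow> take m \<sigma> \<in> T m"
  by (auto simp: T_def take_res)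

lemma tree_of_level: "\<sigma> \<in> tree_of H G \<Longrightarrow> \<sigma> \<in> T (length \<sigma>)"
  by (auto simp: tree_of_def T_def res_def)

lemma subgroup_A: "subgroup (A m) (F (Suc m))"
proof -
  interpret E: group "F (Suc m)" by (rule group_F)
  interpret t: group_hom "F (Suc m)" "F m" "take m" by (rule group_hom_take) simp
  have "A m = T (Suc m) \<inter> kernel (F (Suc m)) (F m) (take m)"
    using T_subset by (auto simp: A_def kernel_def)
  then show ?thesis
    by (simp only: E.subgroups_Inter_pair subgroup_T t.subgroup_kernel)
qed

lemma countable_A: "countable (A m)"
proof (rule countable_subset[OF _ countable_full_tree[of H]])
  show "A m \<subseteq> full_tree H"
    using T_subset by (auto simp: A_def full_tree_def)
qed (rule countable_H)

lemma initial_kernel_eq: "initial_kernel H G m = G \<inter> kernel P (F m) (res m)"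
  using subgroup.subset[OF subgroup_G]
  by (auto simp: initial_kernel_def kernel_def res_def one_fin_product)

lemma subgroup_initial_kernel: "subgroup (initial_kernel H G m) P"
  unfolding initial_kernel_eq
  by (intro group.subgroups_Inter_pair group_P subgroup_G group_hom.subgroup_kernel[OF group_hom_res])

text \<open>Restriction to the first \<open>Suc m\<close> coordinates maps
  \<open>initial_kernel H G m\<close> onto \<open>A m\<close> with kernel
  \<open>initial_kernel H G (Suc m)\<close>, so the first isomorphism theorem applies. The inverse
  isomorphism is the injective homomorphism along which p-compactness is pulled back.\<close>

lemma p_compact_A:
  assumes "prime p"
  shows "p_compact p (F (Suc m)\<lparr>carrier := A m\<rparr>)"
proof -
  let ?N = "P\<lparr>carrier := initial_kernel H G m\<rparr>"
  interpret r: group_hom P "F (Suc m)" "res (Suc m)" by (rule group_hom_res)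
  have img: "res (Suc m) ` carrier ?N = A m"
    using subgroup.subset[OF subgroup_G]
    by (auto simp: initial_kernel_eq kernel_def A_def T_def take_res simp del: carrier_product_group)
  interpret g: group_hom ?N "F (Suc m)\<lparr>carrier := A m\<rparr>" "res (Suc m)"
  proof (intro group_hom.intro group_hom_axioms.intro homI
      subgroup.subgroup_is_group[OF subgroup_A group_F]
      subgroup.subgroup_is_group[OF subgroup_initial_kernel group_P])
    show "res (Suc m) x \<in> carrier (F (Suc m)\<lparr>carrier := A m\<rparr>)" if "x \<in> carrier ?N" for x
      using that img by auto
    show "res (Suc m) (x \<otimes>\<^bsub>?N\<^esub> y) = res (Suc m) x \<otimes>\<^bsub>F (Suc m)\<lparr>carrier := A m\<rparr>\<^esub> res (Suc m) y"
      if "x \<in> carrier ?N" "y \<in> carrier ?N" for x y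
    proof -
      have "x \<in> carrier P" "y \<in> carrier P"
        using that subgroup.subset[OF subgroup_initial_kernel] by auto
      then show ?thesis using r.hom_mult by simp
    qed
  qed
  have ker: "kernel ?N (F (Suc m)\<lparr>carrier := A m\<rparr>) (res (Suc m)) = initial_kernel H G (Suc m)"
    by (auto simp: kernel_def initial_kernel_def res_def one_fin_product simp del: upt_Suc)
  have iso: "(\<lambda>X. the_elem (res (Suc m) ` X)) \<in>
      iso (filtration_quotient H G m) (F (Suc m)\<lparr>carrier := A m\<rparr>)"
    using g.FactGroup_iso_set img unfolding ker filtration_quotient_def by simp
  have "group (filtration_quotient H G m)"
    unfolding filtration_quotient_def ker[symmetric]
    by (intro normal.factorgroup_is_group g.normal_kernel)
  then have "\<exists>h. h \<in> iso (F (Suc m)\<lparr>carrier := A m\<rparr>) (filtration_quotient H G m)"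
    using group.iso_set_sym[OF _ iso] by blast
  then show ?thesis
    using \<open>group (filtration_quotient H G m)\<close>
      subgroup.subgroup_is_group[OF subgroup_A group_F] p_compact_quotient[OF assms]
    by (auto simp: iso_def bij_betw_def intro: p_compact_inj_hom)
qed

text \<open>\<open>T (Suc m)\<close> is an extension of a torsion group by \<open>A m\<close>: a
  power that kills the restriction of \<open>\<sigma>\<close> lands in \<open>A m\<close>, which is
  torsion by p-compactness at the prime 2.\<close>

lemma torsion_T: "\<sigma> \<in> T m \<Longrightarrow> \<exists>k>0. \<sigma> [^]\<^bsub>F m\<^esub> (k::nat) = \<one>\<^bsub>F m\<^esub>"
proof (induction m arbitrary: \<sigma>)
  case 0
  interpret group "F 0" by (rule group_F)
  have "\<sigma> [^]\<^bsub>F 0\<^esub> (1::nat) = \<one>\<^bsub>F 0\<^esub>"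
    using T_subset[of 0] 0 by (auto simp: carrier_fin_product one_fin_product)
  then show ?case by (intro exI[of _ 1]) simp
next
  case (Suc m)
  interpret E: comm_group "F (Suc m)" by (rule comm_group_F)
  interpret t: group_hom "F (Suc m)" "F m" "take m" by (rule group_hom_take) simp
  interpret A: comm_group "F (Suc m)\<lparr>carrier := A m\<rparr>"
    by (rule E.subgroup_is_comm_group[OF subgroup_A])
  have \<sigma>: "\<sigma> \<in> carrier (F (Suc m))" using Suc.prems T_subset by blast
  obtain k :: nat where k: "0 < k" "take m \<sigma> [^]\<^bsub>F m\<^esub> k = \<one>\<^bsub>F m\<^esub>"
    using Suc.IH take_T[OF Suc.prems, of m] by auto
  have "\<sigma> [^]\<^bsub>F (Suc m)\<^esub> k \<in> T (Suc m)"
    using E.subgroup_int_pow_closed[OF subgroup_T Suc.prems, of "int k"] by (simp add: int_pow_int)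
  then have "\<sigma> [^]\<^bsub>F (Suc m)\<^esub> k \<in> A m"
    using k(2) \<sigma> by (simp add: A_def t.hom_nat_pow)
  then obtain l :: nat where "0 < l" "(\<sigma> [^]\<^bsub>F (Suc m)\<^esub> k) [^]\<^bsub>F (Suc m)\<^esub> l = \<one>\<^bsub>F (Suc m)\<^esub>"
    using A.p_compact_imp_torsion[OF p_compact_A[OF two_is_prime_nat]]
    by (auto simp flip: E.nat_pow_consistent)
  then show ?case
    using k(1) \<sigma> by (intro exI[of _ "k * l"]) (simp add: E.nat_pow_pow)
qed

text \<open>One step of pruning for a group tree with levels \<open>K m\<close>. The images
  \<open>L n\<close> of the levels \<open>Suc m + n\<close> in level \<open>Suc m\<close> decrease,
  and \<open>\<sigma>\<close> has an extension in each; \<open>p_compact_lift\<close> along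
  \<open>take m\<close> finds one extension common to all of them.\<close>

lemma extend_thread:
  assumes K: "\<And>m. m \<ge> 1 \<Longrightarrow> subgroup (K m) (F m)" "\<And>m. m \<ge> 1 \<Longrightarrow> K m \<subseteq> T m"
    "\<And>m \<tau>. m \<ge> 1 \<Longrightarrow> \<tau> \<in> K (Suc m) \<Longrightarrow> take m \<tau> \<in> K m"
    and \<sigma>: "m \<ge> 1" "\<And>n. \<exists>\<tau>\<in>K (m + n). take m \<tau> = \<sigma>"
  shows "\<exists>\<rho>. take m \<rho> = \<sigma> \<and> (\<forall>n. \<exists>\<tau>\<in>K (Suc m + n). take (Suc m) \<tau> = \<rho>)"
proof -
  interpret E: comm_group "F (Suc m)" by (rule comm_group_F)
  interpret t: group_hom "F (Suc m)" "F m" "take m" by (rule group_hom_take) simp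
  define L where "L n = take (Suc m) ` K (Suc m + n)" for n
  have L0: "L 0 \<subseteq> T (Suc m)"
    using K(2)[of "Suc m"] by (auto simp: L_def intro: take_T)
  have "(\<Inter>n. take m ` L n) \<subseteq> take m ` (\<Inter>n. L n)"
  proof (rule E.p_compact_lift[OF group_F t.homh subgroup_A countable_A p_compact_A])
    show "subgroup (L n) (F (Suc m))" for n
      unfolding L_def by (rule group_hom.subgroup_img_is_subgroup[OF group_hom_take K(1)]) auto
    show "L (Suc n) \<subseteq> L n" for n
    proof
      fix x assume "x \<in> L (Suc n)"
      then obtain \<tau> where \<tau>: "\<tau> \<in> K (Suc (Suc m + n))" "x = take (Suc m) \<tau>"
        by (auto simp: L_def)
      then have "take (Suc m + n) \<tau> \<in> K (Suc m + n)" by (intro K(3)) auto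
      moreover have "x = take (Suc m) (take (Suc m + n) \<tau>)" using \<tau>(2) by (simp add: min_def)
      ultimately show "x \<in> L n" unfolding L_def by blast
    qed
    show "\<exists>k>0. x [^]\<^bsub>F (Suc m)\<^esub> (k::nat) = \<one>\<^bsub>F (Suc m)\<^esub>" if "x \<in> L 0" for x
      using that L0 torsion_T by blast
    show "x \<in> A m" if "x \<in> L 0" "take m x = \<one>\<^bsub>F m\<^esub>" for x
      using that L0 by (auto simp: A_def)
  qed
  \<comment> \<open>Level \<open>Suc m + n\<close> is level \<open>m + Suc n\<close>, so the
    hypothesis on \<open>\<sigma>\<close> is used one index further.\<close>
  moreover have "\<sigma> \<in> take m ` L n" for n
  proof -
    obtain \<tau> where "\<tau> \<in> K (m + Suc n)" "take m \<tau> = \<sigma>" using \<sigma>(2) by blast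
    then show ?thesis by (force simp: L_def min_def image_image)
  qed
  ultimately obtain \<rho> where "take m \<rho> = \<sigma>" "\<And>n. \<rho> \<in> L n" by blast
  then show ?thesis by (fastforce simp: L_def)
qed

end

section \<open>Derivatives of trees\<close>

lemma is_tree_level:
  "is_tree H S \<Longrightarrow> \<sigma> \<in> S \<Longrightarrow> \<sigma> \<noteq> [] \<and> \<sigma> \<in> carrier (fin_product H (length \<sigma>))"
  by (metis full_tree_iff is_tree_def subsetD)

lemma is_tree_take:
  assumes "is_tree H S" "\<tau> \<in> S" "0 < k" "k \<le> length \<tau>"
  shows "take k \<tau> \<in> S"
proof -
  have "take k \<tau> \<in> full_tree H"
    using is_tree_level[OF assms(1,2)] assms(3,4) by (auto simp: full_tree_iff carrier_fin_product)
  then show ?thesis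
    using assms(1,2) take_is_prefix unfolding is_tree_def by blast
qed

text \<open>Each derivative demands one more level above a node, and closure under restriction trims
  longer extensions to the exact length. The clause \<open>\<sigma> \<noteq> []\<close> keeps out
  the empty list, which every node extends but which is not a node.\<close>

lemma tree_deriv_funpow:
  assumes S: "is_tree H S"
  shows "(tree_deriv ^^ n) S =
    {\<sigma>. \<sigma> \<noteq> [] \<and> (\<exists>\<tau>\<in>S. length \<tau> = length \<sigma> + n \<and> take (length \<sigma>) \<tau> = \<sigma>)}"
proof (induction n)
  case 0
  then show ?case using is_tree_level[OF S] by auto
next
  case (Suc n)
  let ?D = "\<lambda>n. {\<sigma>. \<sigma> \<noteq> [] \<and> (\<exists>\<tau>\<in>S. length \<tau> = length \<sigma> + n \<and> take (length \<sigma>) \<tau> = \<sigma>)}"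
  have "tree_deriv (?D n) = ?D (Suc n)"
  proof (intro equalityI subsetI)
    fix \<sigma> assume "\<sigma> \<in> tree_deriv (?D n)"
    then obtain \<tau> where \<tau>: "\<sigma> \<in> ?D n" "\<tau> \<in> ?D n" "prefix \<sigma> \<tau>" "length \<sigma> < length \<tau>"
      unfolding tree_deriv_def by blast
    moreover from \<tau>(2) obtain \<upsilon> where
      "\<upsilon> \<in> S" "length \<upsilon> = length \<tau> + n" "take (length \<tau>) \<upsilon> = \<tau>"
      by blast
    moreover have "take (length \<sigma>) \<tau> = \<sigma>" using \<tau>(3) by (auto simp: prefix_def)
    ultimately have *: "\<sigma> \<noteq> []" "take (length \<sigma>) \<tau> = \<sigma>" "length \<sigma> < length \<tau>"
      "\<upsilon> \<in> S" "length \<upsilon> = length \<tau> + n" "take (length \<tau>) \<upsilon> = \<tau>"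
      by blast+
    have "take (length \<sigma> + Suc n) \<upsilon> \<in> S"
      using * by (intro is_tree_take[OF S]) auto
    moreover have "take (length \<sigma>) (take (length \<sigma> + Suc n) \<upsilon>) = \<sigma>"
      using * by (metis le_add1 less_imp_le min.absorb1 take_take)
    ultimately show "\<sigma> \<in> ?D (Suc n)"
      using * by (auto intro!: bexI[of _ "take (length \<sigma> + Suc n) \<upsilon>"])
  next
    fix \<sigma> assume "\<sigma> \<in> ?D (Suc n)"
    then obtain \<upsilon> where *: "\<sigma> \<noteq> []" "\<upsilon> \<in> S" "length \<upsilon> = length \<sigma> + Suc n" "take (length \<sigma>) \<upsilon> = \<sigma>"
      by auto
    have "take (length \<sigma> + n) \<upsilon> \<in> S"
      using * by (intro is_tree_take[OF S]) auto
    then have "\<sigma> \<in> ?D n"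
      using * by (auto intro!: bexI[of _ "take (length \<sigma> + n) \<upsilon>"])
    \<comment> \<open>The immediate successor of \<open>\<sigma>\<close> along
      \<open>\<upsilon>\<close> survives \<open>n\<close> derivatives, having
      \<open>\<upsilon>\<close> exactly \<open>n\<close> levels above it.\<close>
    moreover have "take (Suc (length \<sigma>)) \<upsilon> \<in> ?D n"
      using * by (auto intro!: bexI[of _ \<upsilon>])
    moreover have "prefix \<sigma> (take (Suc (length \<sigma>)) \<upsilon>)"
      using * by (metis take_is_prefix take_take min.absorb1 le_SucI order_refl)
    moreover have "length \<sigma> < length (take (Suc (length \<sigma>)) \<upsilon>)"
      using * by simp
    ultimately show "\<sigma> \<in> tree_deriv (?D n)"
      unfolding tree_deriv_def by blast
  qed
  then show ?case by (simp add: Suc.IH)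
qed

lemma tree_deriv_iter_add:
  "tree_deriv_iter ((ord_succ ^^ n) \<alpha>) S = (tree_deriv ^^ n) (tree_deriv_iter \<alpha> S)"
  by (induction n) (simp_all add: tree_deriv_iter_succ)

text \<open>\<open>ord_omega\<close> is a limit and the finite ordinals are cofinal in it, so the
  intersection over all smaller ordinals reduces to one over the natural numbers.\<close>

lemma tree_deriv_iter_omega: "tree_deriv_iter ord_omega S = (\<Inter>n. (tree_deriv ^^ n) S)"
proof -
  have less: "(ord_succ ^^ n) 0 < ord_omega" for n
    using ord_less_omega_iff by blast
  have "ord_omega \<noteq> ord_succ \<beta>" for \<beta>
  proof
    assume eq: "ord_omega = ord_succ \<beta>"
    then have "\<beta> < ord_omega" by (metis ord_less_succ)
    then obtain n where "\<beta> \<le> (ord_succ ^^ n) 0" using ord_less_omega_iff by blast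
    then have "\<beta> < (ord_succ ^^ Suc n) 0" by simp
    moreover have "(ord_succ ^^ Suc n) 0 \<le> \<beta>" using less[of "Suc n"] by (simp only: eq ord_less_succ_iff)
    ultimately show False by (meson leD)
  qed
  moreover have "ord_omega \<noteq> 0" using less[of 0] by auto
  ultimately have "tree_deriv_iter ord_omega S = (\<Inter>\<beta>\<in>{..<ord_omega}. tree_deriv_iter \<beta> S)"
    by (intro tree_deriv_iter_limit) auto
  also have "\<dots> = (\<Inter>n. tree_deriv_iter ((ord_succ ^^ n) 0) S)"
  proof (intro equalityI)
    show "(\<Inter>n. tree_deriv_iter ((ord_succ ^^ n) 0) S) \<subseteq> (\<Inter>\<beta>\<in>{..<ord_omega}. tree_deriv_iter \<beta> S)"
    proof (rule INT_greatest)
      fix \<beta> assume "\<beta> \<in> {..<ord_omega}"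
      then obtain n where "\<beta> \<le> (ord_succ ^^ n) 0" using ord_less_omega_iff by blast
      then show "(\<Inter>n. tree_deriv_iter ((ord_succ ^^ n) 0) S) \<subseteq> tree_deriv_iter \<beta> S"
        using tree_deriv_iter_antimono by blast
    qed
  qed (use less in blast)
  finally show ?thesis by (simp add: tree_deriv_iter_add tree_deriv_iter_0)
qed

lemma tree_height_le: "tree_deriv (tree_deriv_iter \<alpha> S) = tree_deriv_iter \<alpha> S \<Longrightarrow> tree_height S \<le> \<alpha>"
  unfolding tree_height_def by (rule Least_le) (simp add: tree_deriv_iter_succ)

lemma tree_deriv_iter_omega_iff:
  assumes "is_tree H S"
  shows "\<sigma> \<in> tree_deriv_iter ord_omega S \<longleftrightarrow>
    \<sigma> \<noteq> [] \<and> (\<forall>n. \<exists>\<tau>\<in>S. length \<tau> = length \<sigma> + n \<and> take (length \<sigma>) \<tau> = \<sigma>)"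
  by (simp add: tree_deriv_iter_omega tree_deriv_funpow[OF assms])

text \<open>This allows \<open>tree_deriv_funpow\<close> to be applied a second time, to the
  derivatives beyond \<open>ord_omega\<close>.\<close>

lemma is_tree_tree_deriv_iter_omega:
  assumes S: "is_tree H S"
  shows "is_tree H (tree_deriv_iter ord_omega S)"
  unfolding is_tree_def
proof (intro conjI ballI impI)
  show "tree_deriv_iter ord_omega S \<subseteq> full_tree H"
    using tree_deriv_iter_antimono[of 0 ord_omega S] S by (auto simp: tree_deriv_iter_0 is_tree_def)
  fix \<tau> \<sigma> assume \<tau>: "\<tau> \<in> tree_deriv_iter ord_omega S" and \<sigma>: "\<sigma> \<in> full_tree H" "prefix \<sigma> \<tau>"
  have "\<exists>\<upsilon>\<in>S. length \<upsilon> = length \<sigma> + n \<and> take (length \<sigma>) \<upsilon> = \<sigma>" for n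
  proof -
    obtain \<upsilon> where \<upsilon>: "\<upsilon> \<in> S" "length \<upsilon> = length \<tau> + n" "take (length \<tau>) \<upsilon> = \<tau>"
      using \<tau> tree_deriv_iter_omega_iff[OF S] by blast
    have le: "length \<sigma> \<le> length \<tau>" and \<sigma>\<tau>: "take (length \<sigma>) \<tau> = \<sigma>"
      using \<sigma>(2) by (auto simp: prefix_def)
    have "take (length \<sigma> + n) \<upsilon> \<in> S"
      using \<upsilon> le \<sigma>(1) by (intro is_tree_take[OF S]) (auto simp: full_tree_iff)
    moreover have "take (length \<sigma>) \<upsilon> = \<sigma>"
      using \<upsilon>(3) \<sigma>\<tau> le by (metis min.absorb1 take_take)
    ultimately show ?thesis
      using \<upsilon>(2) le by (intro bexI[of _ "take (length \<sigma> + n) \<upsilon>"]) auto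
  qed
  then show "\<sigma> \<in> tree_deriv_iter ord_omega S"
    using \<sigma>(1) by (simp add: tree_deriv_iter_omega_iff[OF S] full_tree_iff)
qed

section \<open>Coset trees and translation to group trees\<close>

lemma (in comm_group) rcoset_closed:
  assumes "subgroup K G" "C \<in> rcosets K"
  shows "C \<subseteq> carrier G"
    and "x \<in> C \<Longrightarrow> y \<in> C \<Longrightarrow> x \<otimes> inv y \<in> K"
    and "k \<in> K \<Longrightarrow> x \<in> C \<Longrightarrow> k \<otimes> x \<in> C"
proof -
  obtain a where a: "a \<in> carrier G" "C = K #> a"
    using assms(2) by (auto simp: RCOSETS_def)
  have KG: "k \<in> carrier G" if "k \<in> K" for k
    using subgroup.subset[OF assms(1)] that by blast
  show "C \<subseteq> carrier G"
    using a KG by (auto simp: r_coset_def)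
  show "x \<otimes> inv y \<in> K" if xy: "x \<in> C" "y \<in> C"
  proof -
    obtain k l where kl: "k \<in> K" "l \<in> K" "x = k \<otimes> a" "y = l \<otimes> a"
      using xy a by (auto simp: r_coset_def)
    then have "x \<otimes> inv y = k \<otimes> inv l"
      using KG a(1) by (simp add: inv_mult_group m_assoc) (simp flip: m_assoc)
    then show ?thesis
      using kl assms(1) by (simp add: subgroup.m_closed subgroup.m_inv_closed)
  qed
  show "k \<otimes> x \<in> C" if kx: "k \<in> K" "x \<in> C"
  proof -
    obtain l where "l \<in> K" "x = l \<otimes> a" using kx(2) a by (auto simp: r_coset_def)
    then show ?thesis
      using KG a kx(1) subgroup.m_closed[OF assms(1), of k l]
      by (auto simp: r_coset_def m_assoc intro!: bexI[of _ "k \<otimes> l"])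
  qed
qed

text \<open>Each level is a coset of itself; both height bounds can therefore use the same
  fixed-point lemma.\<close>

lemma (in p_compact_filtration) group_tree_imp_coset_tree:
  assumes "group_tree H S"
  shows "coset_tree H S"
  unfolding coset_tree_def
proof (intro conjI allI impI disjI2)
  show "is_tree H S" using assms by (simp add: group_tree_def)
  fix m :: nat assume "1 \<le> m"
  then have sub: "subgroup (S \<inter> carrier (F m)) (F m)" using assms by (simp add: group_tree_def)
  then show "\<exists>K. subgroup K (F m) \<and> S \<inter> carrier (F m) \<in> rcosets\<^bsub>F m\<^esub> K"
    by (intro exI[of _ "S \<inter> carrier (F m)"] conjI subgroup.subgroup_in_rcosets group_F)
qed

text \<open>Differences of elements of a coset tree form a group tree, to which \<open>extend_thread\<close> applies.\<close>

lemma (in p_compact_filtration) tree_deriv_iter_omega_fixed: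
  assumes coset: "coset_tree H S" and S: "S \<subseteq> tree_of H G"
    and ne: "\<And>m. 1 \<le> m \<Longrightarrow> \<exists>\<tau>\<in>tree_deriv_iter ord_omega S. length \<tau> = m"
  shows "tree_deriv (tree_deriv_iter ord_omega S) = tree_deriv_iter ord_omega S" (is "tree_deriv ?W = ?W")
proof
  have tree: "is_tree H S" using coset by (simp add: coset_tree_def)
  note W_iff = tree_deriv_iter_omega_iff[OF tree]
  define L where "L m = S \<inter> carrier (F m)" for m
  have L_iff: "\<tau> \<in> L m \<longleftrightarrow> \<tau> \<in> S \<and> length \<tau> = m" for \<tau> m
    using is_tree_level[OF tree] by (auto simp: L_def carrier_fin_product)
  have L_ne: "L m \<noteq> {}" if m: "1 \<le> m" for m
  proof -
    have "?W \<subseteq> S" using tree_deriv_iter_antimono[of 0 ord_omega S] by (simp add: tree_deriv_iter_0)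
    then show ?thesis using ne[OF m] L_iff by blast
  qed
  have "\<exists>K. 1 \<le> m \<longrightarrow> subgroup K (F m) \<and> L m \<in> rcosets\<^bsub>F m\<^esub> K" for m
    using coset L_ne[of m] unfolding coset_tree_def L_def by blast
  then obtain K where K: "\<And>m. 1 \<le> m \<Longrightarrow> subgroup (K m) (F m)"
    "\<And>m. 1 \<le> m \<Longrightarrow> L m \<in> rcosets\<^bsub>F m\<^esub> (K m)"
    by metis
  note rc = comm_group.rcoset_closed[OF comm_group_F K]
  \<comment> \<open>Writing \<open>\<kappa>\<close> as the quotient of
    \<open>\<kappa> \<otimes> y\<close> by \<open>y\<close>, both in \<open>L m\<close>, transfers
    to \<open>K\<close> the properties of the levels of \<open>S\<close>: inclusion in
    \<open>T m\<close> and closure under restriction.\<close>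
  have K_diff: "\<exists>x\<in>L m. \<exists>y\<in>L m. \<kappa> = x \<otimes>\<^bsub>F m\<^esub> inv\<^bsub>F m\<^esub> y" if m: "1 \<le> m" and \<kappa>: "\<kappa> \<in> K m" for m \<kappa>
  proof -
    interpret group "F m" by (rule group_F)
    obtain y where y: "y \<in> L m" using L_ne[OF m] by blast
    have "\<kappa> \<otimes>\<^bsub>F m\<^esub> y \<in> L m" using rc(3)[OF m m \<kappa> y] .
    moreover have "\<kappa> = \<kappa> \<otimes>\<^bsub>F m\<^esub> y \<otimes>\<^bsub>F m\<^esub> inv\<^bsub>F m\<^esub> y"
    proof -
      have "y \<in> carrier (F m)" using y by (simp add: L_def)
      moreover have "\<kappa> \<in> carrier (F m)" using subgroup.subset[OF K(1)[OF m]] \<kappa> by blast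
      ultimately show ?thesis by (simp add: m_assoc)
    qed
    ultimately show ?thesis using y by blast
  qed
  have L_take: "take m \<tau> \<in> L m" if "\<tau> \<in> L n" "1 \<le> m" "m \<le> n" for m n \<tau>
    using that is_tree_take[OF tree, of \<tau> m] by (auto simp: L_iff)
  have K_T: "K m \<subseteq> T m" if m: "1 \<le> m" for m
  proof
    fix \<kappa> assume "\<kappa> \<in> K m"
    then obtain x y where xy: "x \<in> L m" "y \<in> L m" "\<kappa> = x \<otimes>\<^bsub>F m\<^esub> inv\<^bsub>F m\<^esub> y"
      using K_diff[OF m] by blast
    have "z \<in> T m" if "z \<in> L m" for z
      using that S tree_of_level[of z] by (auto simp: L_iff)
    with xy(1,2) have "x \<in> T m" "y \<in> T m" by blast+
    then show "\<kappa> \<in> T m"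
      using subgroup_T[of m] by (simp add: xy(3) subgroup.m_closed subgroup.m_inv_closed)
  qed
  have K_take: "take m \<kappa> \<in> K m" if m: "1 \<le> m" and \<kappa>: "\<kappa> \<in> K (Suc m)" for m \<kappa>
  proof -
    interpret t: group_hom "F (Suc m)" "F m" "take m" by (rule group_hom_take) simp
    obtain x y where xy: "x \<in> L (Suc m)" "y \<in> L (Suc m)" "\<kappa> = x \<otimes>\<^bsub>F (Suc m)\<^esub> inv\<^bsub>F (Suc m)\<^esub> y"
      using K_diff[OF _ \<kappa>] by auto
    have "take m \<kappa> = take m x \<otimes>\<^bsub>F m\<^esub> inv\<^bsub>F m\<^esub> take m y"
      using xy by (simp add: L_def)
    then show ?thesis
      using rc(2)[OF m m L_take[OF xy(1) m] L_take[OF xy(2) m]] by simp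
  qed
  show "tree_deriv ?W \<subseteq> ?W" by (auto simp: tree_deriv_def)
  show "?W \<subseteq> tree_deriv ?W"
  proof
    fix \<sigma> assume \<sigma>: "\<sigma> \<in> ?W"
    define m where "m = length \<sigma>"
    have m: "1 \<le> m" using \<sigma> W_iff by (simp add: m_def Suc_le_eq)
    \<comment> \<open>\<open>\<tau>\<close> is any node of \<open>?W\<close> one level higher and
      need not extend \<open>\<sigma>\<close>. The difference of \<open>\<sigma>\<close> and
      \<open>take m \<tau>\<close> is extended inside the group tree, and multiplying by
      \<open>\<tau>\<close> then gives a successor of \<open>\<sigma>\<close>.\<close>
    obtain \<tau> where \<tau>: "\<tau> \<in> ?W" "length \<tau> = Suc m" using ne[of "Suc m"] by auto
    have "\<exists>\<upsilon>\<in>L (m + n). take m \<upsilon> = \<sigma>" for n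
      using \<sigma> by (simp add: W_iff L_iff m_def Bex_def conj_assoc)
    then obtain s where s: "\<And>n. s n \<in> L (m + n)" "\<And>n. take m (s n) = \<sigma>" by metis
    have "\<exists>\<upsilon>\<in>L (Suc m + n). take (Suc m) \<upsilon> = \<tau>" for n
      using \<tau> by (simp add: W_iff L_iff Bex_def conj_assoc)
    then obtain t where t: "\<And>n. t n \<in> L (Suc m + n)" "\<And>n. take (Suc m) (t n) = \<tau>" by metis
    interpret Fm: comm_group "F m" by (rule comm_group_F)
    have mem: "\<sigma> \<in> carrier (F m)" "take m \<tau> \<in> carrier (F m)"
    proof -
      have "take m \<tau> = take m (t 0)" unfolding t(2)[of 0, symmetric] by (simp add: min_def)
      then have "\<sigma> \<in> L m" "take m \<tau> \<in> L m"
        using L_take[OF s(1)[of 0] m] s(2)[of 0] L_take[OF t(1)[of 0] m] by simp_all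
      then show "\<sigma> \<in> carrier (F m)" "take m \<tau> \<in> carrier (F m)" by (simp_all add: L_def)
    qed
    let ?\<delta> = "\<sigma> \<otimes>\<^bsub>F m\<^esub> inv\<^bsub>F m\<^esub> take m \<tau>"
    have "\<exists>\<kappa>\<in>K (m + n). take m \<kappa> = ?\<delta>" for n
    proof -
      interpret h: group_hom "F (m + n)" "F m" "take m" by (rule group_hom_take) simp
      \<comment> \<open>\<open>t n\<close> reaches level \<open>Suc m + n\<close>, so it is cut by
        one entry to be comparable with \<open>s n\<close>.\<close>
      have t': "take (m + n) (t n) \<in> L (m + n)"
        using m by (intro L_take[OF t(1)]) auto
      have tm: "take m (take (m + n) (t n)) = take m \<tau>"
        unfolding t(2)[symmetric, of n] by (simp add: min_def)
      have "s n \<otimes>\<^bsub>F (m + n)\<^esub> inv\<^bsub>F (m + n)\<^esub> take (m + n) (t n) \<in> K (m + n)"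
        using m by (intro rc(2) s(1) t') auto
      moreover have "take m (s n \<otimes>\<^bsub>F (m + n)\<^esub> inv\<^bsub>F (m + n)\<^esub> take (m + n) (t n)) = ?\<delta>"
        using s[of n] t' tm by (simp add: L_def del: take_take)
      ultimately show ?thesis by blast
    qed
    then obtain \<rho> where \<rho>: "take m \<rho> = ?\<delta>" "\<And>n. \<exists>\<kappa>\<in>K (Suc m + n). take (Suc m) \<kappa> = \<rho>"
      using extend_thread[of K m ?\<delta>] K(1) K_T K_take m by blast
    define \<upsilon> where "\<upsilon> = \<rho> \<otimes>\<^bsub>F (Suc m)\<^esub> \<tau>"
    \<comment> \<open>Extensions of \<open>\<upsilon>\<close> of every length come from translating
      an extension \<open>\<kappa>\<close> of \<open>\<rho>\<close> by the extension
      \<open>t n\<close> of \<open>\<tau>\<close>; hence \<open>\<upsilon> \<in> ?W\<close>.\<close>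
    have \<upsilon>: "\<exists>x\<in>L (Suc m + n). take (Suc m) x = \<upsilon>" for n
    proof -
      interpret h: group_hom "F (Suc m + n)" "F (Suc m)" "take (Suc m)" by (rule group_hom_take) simp
      obtain \<kappa> where \<kappa>: "\<kappa> \<in> K (Suc m + n)" "take (Suc m) \<kappa> = \<rho>" using \<rho>(2) by blast
      have "\<kappa> \<otimes>\<^bsub>F (Suc m + n)\<^esub> t n \<in> L (Suc m + n)"
        by (intro rc(3) \<kappa>(1) t(1)) auto
      moreover have "take (Suc m) (\<kappa> \<otimes>\<^bsub>F (Suc m + n)\<^esub> t n) = \<upsilon>"
        using \<kappa> t[of n] subgroup.subset[OF K(1), of "Suc m + n"]
        by (subst h.hom_mult) (auto simp: \<upsilon>_def L_def)
      ultimately show ?thesis by blast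
    qed
    interpret h: group_hom "F (Suc m)" "F m" "take m" by (rule group_hom_take) simp
    have "length \<upsilon> = Suc m" using \<upsilon>[of 0] by (auto simp: L_iff)
    then have "\<upsilon> \<in> ?W"
      using \<upsilon> by (fastforce simp: W_iff L_iff)
    moreover have "take m \<upsilon> = \<sigma>"
    proof -
      have "\<rho> \<in> carrier (F (Suc m))"
        using \<rho>(2)[of 0] subgroup.subset[OF K(1), of "Suc m"] by (auto simp: carrier_fin_product)
      moreover have "\<tau> \<in> carrier (F (Suc m))"
        using t[of 0] by (auto simp: L_def carrier_fin_product)
      ultimately have "take m \<upsilon> = ?\<delta> \<otimes>\<^bsub>F m\<^esub> take m \<tau>"
        by (simp add: \<upsilon>_def \<rho>(1))
      then show ?thesis using mem by (simp add: Fm.m_assoc)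
    qed
    ultimately show "\<sigma> \<in> tree_deriv ?W"
      using \<sigma> \<open>length \<upsilon> = Suc m\<close> take_is_prefix[of m \<upsilon>]
      unfolding tree_deriv_def by (auto simp: m_def intro!: bexI[of _ \<upsilon>])
  qed
qed

section \<open>Height bounds for group trees and coset trees\<close>

theorem theorem5p8:
  fixes H :: "nat \<Rightarrow> ('a, 'b) monoid_scheme" and G :: "(nat \<Rightarrow> 'a) set"
  assumes "\<And>n. comm_group (H n)"
    and "\<And>n. countable (carrier (H n))"
    and "subgroup G (product_group UNIV H)"
    and "closedin (product_topology (\<lambda>n. discrete_topology (carrier (H n))) UNIV) G"
    and "\<And>p n. prime p \<Longrightarrow> p_compact p (filtration_quotient H G n)"
  shows "(\<forall>S. group_tree H S \<and> S \<subseteq> tree_of H G \<longrightarrow> tree_height S \<le> ord_omega) \<and>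
         (\<forall>S. coset_tree H S \<and> S \<subseteq> tree_of H G \<longrightarrow> tree_height S < ord_omega_2)"
proof -
  interpret p_compact_filtration H G
    by (intro p_compact_filtration.intro assms(1-3,5))
  show ?thesis
  proof (intro conjI allI impI; elim conjE)
    fix S assume S: "group_tree H S" "S \<subseteq> tree_of H G"
    then have tree: "is_tree H S" by (simp add: group_tree_def)
    \<comment> \<open>The identity sequences of all lengths extend one another inside
      \<open>S\<close>, so every level of its derivative of order \<open>ord_omega\<close> is
      nonempty.\<close>
    have one: "\<one>\<^bsub>F m\<^esub> \<in> S" if "1 \<le> m" for m
      using S(1) subgroup.one_closed that unfolding group_tree_def by blast
    have "\<one>\<^bsub>F m\<^esub> \<in> tree_deriv_iter ord_omega S" if m: "1 \<le> m" for m
      unfolding tree_deriv_iter_omega_iff[OF tree]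
    proof (intro conjI allI bexI)
      show "\<one>\<^bsub>F (m + n)\<^esub> \<in> S" for n using m by (intro one) simp
    qed (use m in \<open>auto simp: one_fin_product take_map\<close>)
    moreover have "length \<one>\<^bsub>F m\<^esub> = m" for m
      by (simp add: one_fin_product)
    ultimately show "tree_height S \<le> ord_omega"
      using group_tree_imp_coset_tree[OF S(1)] S(2)
      by (intro tree_height_le tree_deriv_iter_omega_fixed) auto
  next
    fix S assume S: "coset_tree H S" "S \<subseteq> tree_of H G"
    let ?W = "tree_deriv_iter ord_omega S"
    have W: "is_tree H ?W"
      using S(1) by (intro is_tree_tree_deriv_iter_omega) (simp add: coset_tree_def)
    have "\<exists>m. tree_height S \<le> (ord_succ ^^ m) ord_omega"
    proof (cases "\<forall>m\<ge>1. \<exists>\<tau>\<in>?W. length \<tau> = m")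
      case True
      then have "tree_height S \<le> ord_omega"
        using S by (intro tree_height_le tree_deriv_iter_omega_fixed) auto
      then show ?thesis by (intro exI[of _ 0]) simp
    next
      case False
      then obtain m where m: "1 \<le> m" "\<And>\<tau>. \<tau> \<in> ?W \<Longrightarrow> length \<tau> \<noteq> m" by blast
      \<comment> \<open>A node surviving \<open>m\<close> further derivatives would have an
        extension in \<open>?W\<close> of length at least \<open>m\<close>, whose restriction lies
        in the empty level \<open>m\<close>. The empty tree is its own derivative, which bounds the
        height by \<omega> + \<open>m\<close>.\<close>
      have "(tree_deriv ^^ m) ?W = {}"
      proof (rule ccontr)
        assume "(tree_deriv ^^ m) ?W \<noteq> {}"
        then obtain \<tau> where "\<tau> \<in> ?W" "m \<le> length \<tau>"
          by (auto simp: tree_deriv_funpow[OF W])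
        then have "take m \<tau> \<in> ?W" "length (take m \<tau>) = m"
          using is_tree_take[OF W, of \<tau> m] m(1) by auto
        then show False using m(2) by blast
      qed
      then have "tree_height S \<le> (ord_succ ^^ m) ord_omega"
        by (intro tree_height_le) (simp add: tree_deriv_iter_add tree_deriv_def)
      then show ?thesis by blast
    qed
    then show "tree_height S < ord_omega_2"
      by (simp add: ord_less_omega_2_iff)
  qed
qed

end
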